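(* Let $q\ge1$ be an integer and $p>2q-1$ real. Let $X$ be a (nonempty) subhypergroup of $(\Pi_q\times\mathbb{R},*_{p,q})$. Then either $X$ is a subgroup of $X_0:=\{0\}\times\mathbb{R}$, or there are $k\in\{1,\ldots,q\}$ and $u\in U_q$ such that $X$ is equal to $$X_{k,u}:=\left\{\left(u\begin{pmatrix}\tilde r&0\\0&0\end{pmatrix}u^*,a\right):\tilde r\in\Pi_k,\ a\in\mathbb{R}\right\}.$$
   Context: For an integer $k\ge 1$, $\Pi_k$ is the cone of Hermitian positive semidefinite complex $k\times k$ matrices; $U_q$ is the unitary group. For $p>2q-1$, $(\Pi_q\times\mathbb{R},*_{p,q})$ is the hypergroup with identity $(0,0)$, involution $\overline{(r,a)}=(r,-a)$ and convolution of point measures $$(\delta_{(r,a)}*_{p,q}\delta_{(s,b)})(f)=\kappa_{p,q}\int_{B_q} f\Bigl(\sqrt{r^2+s^2+rws+(rws)^*},\,a+b-\operatorname{Im}\operatorname{tr}(rws)\Bigr)\Delta(I_q-w^*w)^{p-2q}\,dw,$$ $f\in C_b(\Pi_q\times\mathbb{R})$, where $B_q$ is the set of complex $q\times q$ matrices $w$ with $I_q-w^*w$ positive definite, $\Delta$ is the determinant, $dw$ Lebesgue measure and $\kappa_{p,q}^{-1}=\int_{B_q}\Delta(I_q-w^*w)^{p-2q}dw$. A closed set $X\subset\Pi_q\times\mathbb{R}$ is a subhypergroup if for all $x,y\in X$ one has $\bar x\in X$ and $\operatorname{supp}(\delta_x*_{p,q}\delta_y)\subset X$. The set $X_0=\{0\}\times\mathbb{R}$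 is a subhypergroup which, with this convolution, is the group $(\mathbb{R},+)$. *)

theory Defs
  imports "HOL-Analysis.Analysis" "HOL-Algebra.Group"
begin

text \<open>
  The dimension \<open>q\<close> is \<open>CARD('q)\<close> for a finite index type \<open>'q\<close>.  Since \<open>k\<close> is a
  bound variable in the classification, \<open>k \<times> k\<close> matrices are functions on indices \<open>< k\<close>;
  the two definiteness predicates over an index set serve both representations.
\<close>

definition hermitian_on :: "'i set \<Rightarrow> ('i \<Rightarrow> 'i \<Rightarrow> complex) \<Rightarrow> bool" where
  "hermitian_on I A \<longleftrightarrow> (\<forall>i\<in>I. \<forall>j\<in>I. A j i = cnj (A i j))"

definition pos_semidef_on :: "'i set \<Rightarrow> ('i \<Rightarrow> 'i \<Rightarrow> complex) \<Rightarrow> bool" where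
  "pos_semidef_on I A \<longleftrightarrow> hermitian_on I A \<and>
     (\<forall>v. 0 \<le> Re (\<Sum>i\<in>I. \<Sum>j\<in>I. cnj (v i) * A i j * v j))"

definition pos_def_on :: "'i set \<Rightarrow> ('i \<Rightarrow> 'i \<Rightarrow> complex) \<Rightarrow> bool" where
  "pos_def_on I A \<longleftrightarrow> hermitian_on I A \<and>
     (\<forall>v. (\<exists>i\<in>I. v i \<noteq> 0) \<longrightarrow> 0 < Re (\<Sum>i\<in>I. \<Sum>j\<in>I. cnj (v i) * A i j * v j))"

definition Pi_nat :: "nat \<Rightarrow> (nat \<Rightarrow> nat \<Rightarrow> complex) set" where
  "Pi_nat k = {A. pos_semidef_on {..<k} A}"

definition Pi_cone :: "(complex^'q^'q) set" where
  "Pi_cone = {A. pos_semidef_on UNIV (\<lambda>i j. A $ i $ j)}"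

definition ctransp :: "complex^'q^'q \<Rightarrow> complex^'q^'q" where
  "ctransp A = (\<chi> i j. cnj (A $ j $ i))"

definition unitary_group :: "(complex^'q^'q) set" where
  "unitary_group = {u. ctransp u ** u = mat 1 \<and> u ** ctransp u = mat 1}"

text \<open>The unique positive semidefinite square root; only meaningful on \<^const>\<open>Pi_cone\<close>.\<close>

definition msqrt :: "complex^'q^'q \<Rightarrow> complex^'q^'q" where
  "msqrt A = (THE S. S \<in> Pi_cone \<and> S ** S = A)"

definition B_ball :: "(complex^'q^'q) set" where
  "B_ball = {w. pos_def_on UNIV (\<lambda>i j. (mat 1 - ctransp w ** w) $ i $ j)}"

text \<open>On \<^const>\<open>B_ball\<close> the determinant is real and positive, so taking the real part loses nothing.\<close>

definition weight :: "real \<Rightarrow> complex^'q^'q \<Rightarrow> real" where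
  "weight p w = Re (det (mat 1 - ctransp w ** w)) powr (p - 2 * real CARD('q))"

definition kappa :: "'q::finite itself \<Rightarrow> real \<Rightarrow> real" where
  "kappa _ p = inverse (set_lebesgue_integral lborel (B_ball :: (complex^'q^'q) set) (weight p))"

text \<open>
  The measure representing the functional
  \<open>f \<mapsto> \<kappa> \<integral>\<^sub>B f (T w) \<Delta>(I - w\<^sup>* w)\<^bsup>p - 2 q\<^esup> dw\<close>, i.e. the image under \<open>T\<close> of the weighted
  Lebesgue measure on the ball.  It is a Borel measure on all of
  \<open>(complex^'q^'q) \<times> real\<close>, concentrated on the closed set \<open>Pi_cone \<times> UNIV\<close>.
\<close>

definition conv_map ::
    "(complex^'q^'q) \<times> real \<Rightarrow> (complex^'q^'q) \<times> real \<Rightarrow> complex^'q^'q \<Rightarrow> (complex^'q^'q) \<times> real" where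
  "conv_map x y w =
     (let (r, a) = x; (s, b) = y; m = r ** w ** s in
       (msqrt (r ** r + s ** s + m + ctransp m), a + b - Im (trace m)))"

definition conv ::
    "real \<Rightarrow> (complex^'q^'q) \<times> real \<Rightarrow> (complex^'q^'q) \<times> real \<Rightarrow> ((complex^'q^'q) \<times> real) measure" where
  "conv p x y =
     distr (density lborel (\<lambda>w. ennreal (kappa TYPE('q) p * (indicator B_ball w * weight p w))))
       borel (conv_map x y)"

definition msupport :: "'a::topological_space measure \<Rightarrow> 'a set" where
  "msupport M = {z. \<forall>U. open U \<and> z \<in> U \<longrightarrow> emeasure M U > 0}"

definition hinv :: "(complex^'q^'q) \<times> real \<Rightarrow> (complex^'q^'q) \<times> real" where
  "hinv x = (fst x, - snd x)"

definition subhypergroup :: "real \<Rightarrow> ((complex^'q^'q) \<times> real) set \<Rightarrow> bool" where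
  "subhypergroup p X \<longleftrightarrow>
     closedin (top_of_set (Pi_cone \<times> UNIV)) X \<and>
     (\<forall>x\<in>X. \<forall>y\<in>X. hinv x \<in> X \<and> msupport (conv p x y) \<subseteq> X)"

text \<open>
  On \<open>{0} \<times> \<real>\<close> the convolution of the point measures at \<open>(0, a)\<close> and \<open>(0, b)\<close>
  is the point measure at \<open>(0, a + b)\<close>.
\<close>

definition X0 :: "((complex^'q^'q) \<times> real) monoid" where
  "X0 = \<lparr>carrier = {0} \<times> UNIV, monoid.mult = (\<lambda>x y. (0, snd x + snd y)), one = (0, 0)\<rparr>"

text \<open>
  The position \<open>0, \<dots>, q - 1\<close> of an index, so that upper left blocks make sense.  The linear
  order on \<open>'q\<close> serves only this purpose and does not restrict the dimension \<open>q\<close>.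
\<close>

definition idx :: "'q::{finite,linorder} \<Rightarrow> nat" where
  "idx i = card {j. j < i}"

definition block :: "nat \<Rightarrow> (nat \<Rightarrow> nat \<Rightarrow> complex) \<Rightarrow> complex^('q::{finite,linorder})^('q::{finite,linorder})" where
  "block k A = (\<chi> i j. if idx i < k \<and> idx j < k then A (idx i) (idx j) else 0)"

definition X_sub :: "nat \<Rightarrow> complex^('q::{finite,linorder})^('q::{finite,linorder}) \<Rightarrow> ((complex^('q::{finite,linorder})^('q::{finite,linorder})) \<times> real) set" where
  "X_sub k u = {(u ** block k A ** ctransp u, a) | A a. A \<in> Pi_nat k}"

end

theory Submission
  imports Defs
begin

text \<open>
  The support of a convolution contains every value of the map
  \<open>w \<mapsto> (\<surd>(r\<^sup>2 + s\<^sup>2 + r w s + (r w s)\<^sup>*), a + b - Im tr (r w s))\<close> on the open ball, since that map is continuous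
  and the weight is positive (\<open>conv_map_in_msupport\<close>).  This needs the normalising constant to be
  nonzero, that is, the integrability of \<open>\<Delta>(I - w\<^sup>* w)\<^sup>a\<close> for \<open>a > -1\<close> (\<open>kappa_pos\<close>), where the
  determinant may vanish to high order at the boundary.  Instead of computing the integral, one
  lets principal minors of \<open>I - w\<^sup>* w\<close> grow by one index at a time: a minor is affine in the square of the scaling
  factor of a column (\<open>defect_colscale_affine\<close>), and scaling that column shows that the part of the
  ball where the new minor is smaller than \<open>\<epsilon>\<close> times the old one has relative mass \<open>O(\<epsilon>)\<close>
  (\<open>nn_integral_boundary_shell\<close>); summing over dyadic \<open>\<epsilon>\<close> gives a convergent geometric series.

  As \<open>X\<close> is closed, it is stable under the map also for \<open>w\<close> in the closed ball
  (\<open>conv_map_in_subhypergroup\<close>), which requires the continuity of the square root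
  (\<open>continuous_on_msqrt\<close>).  If all cone parts vanish, \<open>X\<close> is closed under addition and negation of
  the real coordinate.  Otherwise let \<open>(r, a) \<in> X\<close> with \<open>r \<noteq> 0\<close>.  Scalar \<open>w\<close> near \<open>-I\<close>, applied to
  large multiples of \<open>r\<close>, shrink the cone part to \<open>0\<close> while keeping any prescribed real coordinate;
  hence \<open>{0} \<times> \<real> \<subseteq> X\<close> and \<open>X\<close> is a product of a set \<open>R\<close> of cone elements with \<open>\<real>\<close>
  (\<open>subhypergroup_contains_vertical_line\<close>).  The set \<open>R\<close> is stable under \<open>(r, s) \<mapsto> \<surd>(r\<^sup>2 + s\<^sup>2)\<close>, so it has
  an element \<open>r\<close> whose kernel is contained in all other kernels (\<open>subhypergroup_minimal_kernel\<close>).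
  Conversely, Hermitian \<open>w\<close> yield \<open>\<surd>(r Z r)\<close> for every positive semidefinite \<open>Z\<close>, which covers all
  positive semidefinite \<open>s\<close> that are right multiples of \<open>r\<close> (\<open>subhypergroup_factor\<close>), equivalently whose kernel contains
  that of \<open>r\<close>.  Diagonalising \<open>r\<close> with decreasing eigenvalues (\<open>spectral_theorem\<close>) turns this
  description of \<open>R\<close> into the block form.
\<close>

text \<open>
  The notation \<open>complex^'q\<close> adds the sort \<open>finite\<close> to every occurrence of \<open>'q\<close>, which conflicts with a
  type variable declared once with a larger sort; these synonyms leave the sort alone.
\<close>

type_synonym 'q cvec = "complex^'q"
type_synonym 'q cmat = "complex^'q^'q"

section \<open>Adjoints and the real inner product\<close>

lemma ctransp_nth [simp]: "ctransp A $ i $ j = cnj (A $ j $ i)"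
  by (simp add: ctransp_def)

lemma ctransp_ctransp [simp]: "ctransp (ctransp A) = A"
  by (simp add: vec_eq_iff)

lemma ctransp_mult: "ctransp (A ** B) = ctransp B ** ctransp (A :: complex^'q^'q)"
  by (simp add: vec_eq_iff matrix_matrix_mult_def mult.commute)

lemma ctransp_add: "ctransp (A + B) = ctransp A + ctransp B"
  by (simp add: vec_eq_iff)

lemma ctransp_diff: "ctransp (A - B) = ctransp A - ctransp B"
  by (simp add: vec_eq_iff)

lemma ctransp_scaleR: "ctransp (t *\<^sub>R A) = t *\<^sub>R ctransp A"
  by (simp add: vec_eq_iff)

lemma ctransp_mat: "ctransp (mat z) = mat (cnj z)"
  by (simp add: vec_eq_iff mat_def)

lemma ctransp_zero [simp]: "ctransp 0 = 0"
  by (simp add: vec_eq_iff)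

lemma continuous_on_ctransp [continuous_intros]:
  "continuous_on S f \<Longrightarrow> continuous_on S (\<lambda>x. ctransp (f x))"
  unfolding ctransp_def by (intro continuous_intros) 

lemma continuous_on_matrix_mult [continuous_intros]:
  fixes f g :: "'a::topological_space \<Rightarrow> complex^'q^'q"
  shows "continuous_on S f \<Longrightarrow> continuous_on S g \<Longrightarrow> continuous_on S (\<lambda>x. f x ** g x)"
  unfolding matrix_matrix_mult_def by (intro continuous_intros)

lemma continuous_on_matrix_vector_mult [continuous_intros]:
  fixes f :: "'a::topological_space \<Rightarrow> complex^'q^'q"
  shows "continuous_on S f \<Longrightarrow> continuous_on S g \<Longrightarrow> continuous_on S (\<lambda>x. f x *v g x)"
  unfolding matrix_vector_mult_def by (intro continuous_intros)

lemma continuous_on_trace [continuous_intros]: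
  fixes f :: "'a::topological_space \<Rightarrow> complex^'q^'q"
  shows "continuous_on S f \<Longrightarrow> continuous_on S (\<lambda>x. trace (f x))"
  unfolding trace_def by (intro continuous_intros)

lemma continuous_on_det [continuous_intros]:
  fixes f :: "'a::topological_space \<Rightarrow> complex^'q^'q"
  shows "continuous_on S f \<Longrightarrow> continuous_on S (\<lambda>x. det (f x))"
  unfolding det_def by (intro continuous_intros)

lemma scaleR_matrix_mult [simp]:
  fixes A B :: "complex^'q^'q"
  shows "(t *\<^sub>R A) ** B = t *\<^sub>R (A ** B)" "A ** (t *\<^sub>R B) = t *\<^sub>R (A ** B)"
  by (simp_all add: vec_eq_iff matrix_matrix_mult_def scaleR_sum_right)

lemma scaleR_matrix_vector_mult:
  fixes A :: "complex^'q^'q"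
  shows "(t *\<^sub>R A) *v v = t *\<^sub>R (A *v v)"
  by (simp add: vec_eq_iff matrix_vector_mult_def scaleR_sum_right)

lemma matrix_vector_mult_scaleR:
  fixes A :: "complex^'q^'q"
  shows "A *v (t *\<^sub>R v) = t *\<^sub>R (A *v v)"
  by (simp add: vec_eq_iff matrix_vector_mult_def scaleR_sum_right)

lemma matrix_mult_diff_left:
  fixes A B C :: "complex^'q^'q"
  shows "(A - B) ** C = A ** C - B ** C"
  by (simp add: vec_eq_iff matrix_matrix_mult_def sum_subtractf algebra_simps)

lemma matrix_mult_diff_right:
  fixes A B C :: "complex^'q^'q"
  shows "C ** (A - B) = C ** A - C ** B"
  by (simp add: vec_eq_iff matrix_matrix_mult_def sum_subtractf algebra_simps)

lemma mat_matrix_mult: "mat z ** (A :: complex^'q^'q) = (\<chi> i j. z * A $ i $ j)"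
  by (simp add: vec_eq_iff matrix_matrix_mult_def mat_def mult_delta_left)

text \<open>
  The real inner product of \<^typ>\<open>complex^'q\<close> is the real part of the Hermitian one, so the adjoint
  for the Hermitian product is also the adjoint for the real product.
\<close>

lemma inner_matrix_vector_mult:
  fixes A :: "complex^'q^'q"
  shows "v \<bullet> (A *v w) = (ctransp A *v v) \<bullet> w"
proof -
  have "v \<bullet> (A *v w) = (\<Sum>i\<in>UNIV. \<Sum>j\<in>UNIV. v $ i \<bullet> (A $ i $ j * w $ j))"
    by (simp add: inner_vec_def matrix_vector_mult_def inner_sum_right)
  also have "\<dots> = (\<Sum>j\<in>UNIV. \<Sum>i\<in>UNIV. (cnj (A $ i $ j) * v $ i) \<bullet> w $ j)"
    by (subst sum.swap) (simp add: inner_complex_def algebra_simps)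
  also have "\<dots> = (ctransp A *v v) \<bullet> w"
    by (simp add: inner_vec_def matrix_vector_mult_def inner_sum_left)
  finally show ?thesis .
qed

lemma quadratic_form_eq_inner:
  "Re (\<Sum>i\<in>UNIV. \<Sum>j\<in>UNIV. cnj (v $ i) * A $ i $ j * v $ j) = v \<bullet> ((A :: complex^'q^'q) *v v)"
  by (simp add: inner_vec_def matrix_vector_mult_def inner_sum_right)
    (simp add: inner_complex_def algebra_simps)

lemma hermitian_on_UNIV_iff: "hermitian_on UNIV (\<lambda>i j. A $ i $ j) \<longleftrightarrow> ctransp A = A"
  unfolding hermitian_on_def vec_eq_iff ctransp_nth by (rule iffI; metis UNIV_I)

lemma Pi_cone_iff: "A \<in> Pi_cone \<longleftrightarrow> ctransp A = A \<and> (\<forall>v. 0 \<le> v \<bullet> (A *v v))"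
proof -
  have "(\<forall>v. 0 \<le> Re (\<Sum>i\<in>UNIV. \<Sum>j\<in>UNIV. cnj (v i) * A $ i $ j * v j)) \<longleftrightarrow> (\<forall>v. 0 \<le> v \<bullet> (A *v v))"
    (is "(\<forall>v. ?P v) \<longleftrightarrow> _")
  proof
    assume "\<forall>v. ?P v"
    then have "?P (\<lambda>i. v $ i)" for v by blast
    then show "\<forall>v. 0 \<le> v \<bullet> (A *v v)" by (simp only: quadratic_form_eq_inner simp_thms)
  next
    assume R: "\<forall>v. 0 \<le> v \<bullet> (A *v v)"
    show "\<forall>v. ?P v"
    proof
      fix v
      have "0 \<le> (\<chi> i. v i) \<bullet> (A *v (\<chi> i. v i))" using R by blast
      then show "?P v" by (simp only: quadratic_form_eq_inner[symmetric] vec_lambda_beta)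
    qed
  qed
  then show ?thesis
    by (simp add: Pi_cone_def pos_semidef_on_def hermitian_on_UNIV_iff)
qed

lemma Pi_cone_hermitian: "A \<in> Pi_cone \<Longrightarrow> ctransp A = A"
  by (simp add: Pi_cone_iff)

lemma Pi_cone_form_nonneg: "A \<in> Pi_cone \<Longrightarrow> 0 \<le> v \<bullet> (A *v v)"
  by (simp add: Pi_cone_iff)

lemma inner_gram: "v \<bullet> ((ctransp w ** w) *v v) = (norm ((w :: complex^'q^'q) *v v))\<^sup>2"
proof -
  have "v \<bullet> ((ctransp w ** w) *v v) = v \<bullet> (ctransp w *v (w *v v))"
    by (simp only: matrix_vector_mul_assoc)
  also have "\<dots> = (w *v v) \<bullet> (w *v v)" by (simp only: inner_matrix_vector_mult[of v] ctransp_ctransp)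
  finally show ?thesis by (simp only: power2_norm_eq_inner)
qed

lemma B_ball_iff: "w \<in> B_ball \<longleftrightarrow> (\<forall>v. v \<noteq> 0 \<longrightarrow> norm (w *v v) < norm v)"
proof -
  let ?A = "mat 1 - ctransp w ** w"
  have form: "v \<bullet> (?A *v v) = (norm v)\<^sup>2 - (norm (w *v v))\<^sup>2" for v
    by (simp add: matrix_vector_mult_diff_rdistrib inner_diff_right inner_gram power2_norm_eq_inner)
  have pos: "0 < v \<bullet> (?A *v v) \<longleftrightarrow> norm (w *v v) < norm v" for v
    unfolding form using power_mono_iff[of "norm v" "norm (w *v v)" 2]
    by (simp add: not_le[symmetric])
  have herm: "hermitian_on UNIV (\<lambda>i j. ?A $ i $ j)"
    unfolding hermitian_on_UNIV_iff by (simp add: ctransp_diff ctransp_mat ctransp_mult)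
  have "(\<forall>v. (\<exists>i\<in>UNIV. v i \<noteq> 0) \<longrightarrow> 0 < Re (\<Sum>i\<in>UNIV. \<Sum>j\<in>UNIV. cnj (v i) * ?A $ i $ j * v j))
      \<longleftrightarrow> (\<forall>v. v \<noteq> 0 \<longrightarrow> 0 < v \<bullet> (?A *v v))" (is "(\<forall>v. ?P v) \<longleftrightarrow> _")
  proof
    assume "\<forall>v. ?P v"
    then have "?P (\<lambda>i. v $ i)" for v by blast
    then show "\<forall>v. v \<noteq> 0 \<longrightarrow> 0 < v \<bullet> (?A *v v)"
      by (simp only: quadratic_form_eq_inner) (simp add: vec_eq_iff)
  next
    assume R: "\<forall>v. v \<noteq> 0 \<longrightarrow> 0 < v \<bullet> (?A *v v)"
    show "\<forall>v. ?P v"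
    proof (intro allI impI)
      fix v :: "'a \<Rightarrow> complex" assume "\<exists>i\<in>UNIV. v i \<noteq> 0"
      then have "(\<chi> i. v i) \<noteq> 0" by (simp add: vec_eq_iff)
      then have "0 < (\<chi> i. v i) \<bullet> (?A *v (\<chi> i. v i))" using R by blast
      then show "0 < Re (\<Sum>i\<in>UNIV. \<Sum>j\<in>UNIV. cnj (v i) * ?A $ i $ j * v j)"
        by (simp only: quadratic_form_eq_inner[symmetric] vec_lambda_beta)
    qed
  qed
  then show ?thesis
    unfolding B_ball_def pos_def_on_def mem_Collect_eq pos using herm by blast
qed

lemma norm_matrix_vector_mult_le: "norm ((A :: complex^'q^'q) *v v) \<le> norm A * norm v"
proof -
  have row: "norm ((A *v v) $ i) \<le> norm (A $ i) * norm v" for i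
  proof -
    have "norm ((A *v v) $ i) \<le> (\<Sum>j\<in>UNIV. norm (A $ i $ j) * norm (v $ j))"
      unfolding matrix_vector_mult_def by (simp add: norm_mult[symmetric] norm_sum)
    also have "\<dots> \<le> norm (A $ i) * norm v"
      unfolding norm_vec_def
      using L2_set_mult_ineq[of "\<lambda>j. norm (A $ i $ j)" "\<lambda>j. norm (v $ j)" UNIV] by (simp add: norm_vec_def)
    finally show ?thesis .
  qed
  have "norm (A *v v) \<le> L2_set (\<lambda>i. norm (A $ i) * norm v) UNIV"
    unfolding norm_vec_def[of "A *v v"] by (rule L2_set_mono) (auto simp: row)
  also have "\<dots> = norm A * norm v"
    unfolding norm_vec_def[of A] by (simp add: L2_set_left_distrib)
  finally show ?thesis .
qed

lemma trace_gram: "trace (ctransp A ** A) = of_real ((norm (A :: complex^'q^'q))\<^sup>2)"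
proof -
  have "trace (ctransp A ** A) = (\<Sum>i\<in>UNIV. \<Sum>k\<in>UNIV. of_real ((norm (A $ k $ i))\<^sup>2))"
    by (simp add: trace_def matrix_matrix_mult_def complex_norm_square mult.commute del: of_real_power)
  also have "\<dots> = of_real ((norm A)\<^sup>2)"
    by (subst sum.swap) (simp add: norm_vec_def L2_set_def real_sqrt_pow2 sum_nonneg)
  finally show ?thesis .
qed

lemma mult_axis_nth: "((A :: complex^'q^'q) *v axis k 1) $ i = A $ i $ k"
  by (simp add: matrix_vector_mult_def axis_def mult_delta_right)

lemma matrix_eq_columnwise:
  fixes A B :: "complex^'q^'q"
  assumes "\<And>k. A *v axis k 1 = B *v axis k 1"
  shows "A = B"
  by (simp add: vec_eq_iff) (metis assms mult_axis_nth)

lemma unitary_mult: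
  assumes "u \<in> unitary_group" "v \<in> unitary_group"
  shows "u ** v \<in> unitary_group"
proof -
  have "ctransp v ** (ctransp u ** u) ** v = mat 1" "u ** (v ** ctransp v) ** ctransp u = mat 1"
    using assms by (simp_all add: unitary_group_def)
  then show ?thesis
    by (simp add: unitary_group_def ctransp_mult matrix_mul_assoc)
qed

lemma unitary_cancel:
  assumes "u \<in> unitary_group"
  shows "ctransp u ** (u ** A) = A" "u ** (ctransp u ** A) = A"
    "A ** u ** ctransp u = A" "A ** ctransp u ** u = A"
proof -
  show "ctransp u ** (u ** A) = A" "u ** (ctransp u ** A) = A"
    using assms by (simp_all add: matrix_mul_assoc unitary_group_def)
  have "A ** (u ** ctransp u) = A" "A ** (ctransp u ** u) = A" 
    using assms by (simp_all add: unitary_group_def)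
  then show "A ** u ** ctransp u = A" "A ** ctransp u ** u = A"
    by (simp_all add: matrix_mul_assoc)
qed

lemma compact_unitary_group: "compact (unitary_group :: (complex^'q^'q) set)"
proof (rule compact_eq_bounded_closed[THEN iffD2], intro conjI)
  have "(norm u)\<^sup>2 = real CARD('q)" if "u \<in> unitary_group" for u :: "complex^'q^'q"
  proof -
    have "of_real ((norm u)\<^sup>2) = (of_nat CARD('q) :: complex)"
      using that trace_gram[of u] by (simp add: unitary_group_def trace_I)
    then show ?thesis by (metis of_real_eq_iff of_real_of_nat_eq)
  qed
  then have "norm u = sqrt (real CARD('q))" if "u \<in> unitary_group" for u :: "complex^'q^'q"
    using that by (metis norm_ge_zero real_sqrt_unique)
  then show "bounded (unitary_group :: (complex^'q^'q) set)"
    by (intro boundedI[where B = "sqrt (real CARD('q))"]) simp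
  have "closed {u :: complex^'q^'q. ctransp u ** u = mat 1}" "closed {u :: complex^'q^'q. u ** ctransp u = mat 1}"
    by (intro closed_Collect_eq continuous_intros)+
  then show "closed (unitary_group :: (complex^'q^'q) set)"
    unfolding unitary_group_def by (simp add: Collect_conj_eq closed_Int)
qed

section \<open>The spectral theorem with sorted eigenvalues\<close>

lemma strict_mono_idx: "i < j \<Longrightarrow> idx i < idx (j :: 'q::{finite,linorder})"
  unfolding idx_def by (rule psubset_card_mono) auto

lemma inj_idx: "inj (idx :: 'q::{finite,linorder} \<Rightarrow> nat)"
  by (rule injI) (metis less_irrefl linorder_neqE strict_mono_idx)

lemma idx_less_card: "idx (i :: 'q::{finite,linorder}) < CARD('q)"
  unfolding idx_def by (rule psubset_card_mono) auto

lemma range_idx: "range (idx :: 'q::{finite,linorder} \<Rightarrow> nat) = {..<CARD('q)}"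
  by (rule card_subset_eq) (auto simp: idx_less_card card_image[OF inj_idx])

text \<open>A unitary rotation of the plane of coordinates \<open>i\<close> and \<open>j\<close>, with cosine \<open>c\<close> and complex sine \<open>s\<close>.\<close>

definition rotation :: "'q \<Rightarrow> 'q \<Rightarrow> real \<Rightarrow> complex \<Rightarrow> complex^'q^'q" where
  "rotation i j c s = (\<chi> a b.
     if b = i then (if a = i then of_real c else if a = j then s else 0)
     else if b = j then (if a = i then - cnj s else if a = j then of_real c else 0)
     else if a = b then 1 else 0)"

lemma sum_supported_on_two:
  fixes f :: "'q::finite \<Rightarrow> 'a::comm_monoid_add"
  assumes "i \<noteq> j" "\<And>k. k \<noteq> i \<Longrightarrow> k \<noteq> j \<Longrightarrow> f k = 0"
  shows "sum f UNIV = f i + f j"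
proof -
  have "sum f UNIV = sum f {i, j}"
    by (rule sum.mono_neutral_right) (use assms in auto)
  then show ?thesis using assms(1) by simp
qed

lemma rotation_unitary:
  fixes i j :: "'q::finite"
  assumes "i \<noteq> j" "c\<^sup>2 + (norm s)\<^sup>2 = 1"
  shows "rotation i j c s \<in> unitary_group"
proof -
  let ?G = "rotation i j c s"
  have norm: "complex_of_real c * complex_of_real c + cnj s * s = 1"
  proof -
    have "complex_of_real (c\<^sup>2 + (norm s)\<^sup>2) = 1" using assms(2) by simp
    then show ?thesis
      by (simp only: of_real_add complex_norm_square) (simp add: power2_eq_square mult.commute)
  qed
  have "(ctransp ?G ** ?G) $ a $ b = mat 1 $ a $ b" for a b
  proof (cases "a = i \<or> a = j")
    case True
    then have "(ctransp ?G ** ?G) $ a $ b = cnj (?G $ i $ a) * ?G $ i $ b + cnj (?G $ j $ a) * ?G $ j $ b"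
      unfolding matrix_matrix_mult_def
      by (simp, intro sum_supported_on_two) (use assms(1) in \<open>auto simp: rotation_def\<close>)
    then show ?thesis
      using True assms(1) norm by (auto simp: rotation_def mat_def mult.commute add.commute)
  next
    case False
    then have "(ctransp ?G ** ?G) $ a $ b = (\<Sum>k\<in>UNIV. if k = a then ?G $ k $ b else 0)"
      unfolding matrix_matrix_mult_def vec_lambda_beta
      by (intro sum.cong) (auto simp: rotation_def)
    then show ?thesis
      using False by (auto simp: rotation_def mat_def)
  qed
  then have "ctransp ?G ** ?G = mat 1" by (simp add: vec_eq_iff)
  then show ?thesis
    by (simp add: unitary_group_def matrix_left_right_inverse)
qed

text \<open>
  Conjugating by a rotation in the plane of \<open>i\<close> and \<open>j\<close> moves the same amount from one of the two
  diagonal entries to the other and leaves the remaining ones alone.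
\<close>

lemma rotation_diagonal:
  fixes A :: "complex^'q^'q"
  assumes "i \<noteq> j" "c\<^sup>2 + (norm s)\<^sup>2 = 1" and herm: "ctransp A = A"
  defines "D \<equiv> \<lambda>k. Re ((ctransp (rotation i j c s) ** A ** rotation i j c s) $ k $ k)"
    and "e \<equiv> (norm s)\<^sup>2 * (Re (A $ j $ j) - Re (A $ i $ i)) + 2 * c * Re (s * A $ i $ j)"
  shows "D i = Re (A $ i $ i) + e" "D j = Re (A $ j $ j) - e"
    "\<And>k. k \<noteq> i \<Longrightarrow> k \<noteq> j \<Longrightarrow> D k = Re (A $ k $ k)"
proof -
  let ?G = "rotation i j c s"
  have Aji: "A $ j $ i = cnj (A $ i $ j)" and real: "Im (A $ k $ k) = 0" for k
    using herm by (metis ctransp_nth, metis Reals_cnj_iff complex_is_Real_iff ctransp_nth)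
  have c2: "c\<^sup>2 = 1 - (norm s)\<^sup>2" using assms(2) by simp
  have s2: "(norm s)\<^sup>2 = (Re s)\<^sup>2 + (Im s)\<^sup>2" by (simp add: cmod_power2)
  have DG: "(ctransp ?G ** A ** ?G) $ k $ k = (\<Sum>b\<in>UNIV. (\<Sum>a\<in>UNIV. cnj (?G $ a $ k) * A $ a $ b) * ?G $ b $ k)" for k
    by (simp add: matrix_matrix_mult_def)
  have two: "(ctransp ?G ** A ** ?G) $ k $ k =
      (cnj (?G $ i $ k) * A $ i $ i + cnj (?G $ j $ k) * A $ j $ i) * ?G $ i $ k
      + (cnj (?G $ i $ k) * A $ i $ j + cnj (?G $ j $ k) * A $ j $ j) * ?G $ j $ k"
    if "k = i \<or> k = j" for k
  proof -
    have inner: "(\<Sum>a\<in>UNIV. cnj (?G $ a $ k) * A $ a $ b) = cnj (?G $ i $ k) * A $ i $ b + cnj (?G $ j $ k) * A $ j $ b" for b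
      by (intro sum_supported_on_two) (use that assms(1) in \<open>auto simp: rotation_def\<close>)
    show ?thesis
      unfolding DG inner
      by (intro sum_supported_on_two) (use that assms(1) in \<open>auto simp: rotation_def\<close>)
  qed
  have "D i = c\<^sup>2 * Re (A $ i $ i) + (norm s)\<^sup>2 * Re (A $ j $ j) + 2 * c * Re (s * A $ i $ j)"
    unfolding D_def two[OF disjI1[OF refl]] s2 using assms(1)
    by (simp add: rotation_def Aji real power2_eq_square algebra_simps)
  then show "D i = Re (A $ i $ i) + e" by (simp add: e_def c2 algebra_simps)
  have "D j = (norm s)\<^sup>2 * Re (A $ i $ i) + c\<^sup>2 * Re (A $ j $ j) - 2 * c * Re (s * A $ i $ j)"
    unfolding D_def two[OF disjI2[OF refl]] s2 using assms(1)
    by (simp add: rotation_def Aji real power2_eq_square algebra_simps)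
  then show "D j = Re (A $ j $ j) - e" by (simp add: e_def c2 algebra_simps)
  show "D k = Re (A $ k $ k)" if "k \<noteq> i" "k \<noteq> j" for k
  proof -
    have 1: "(\<Sum>a\<in>UNIV. cnj (?G $ a $ k) * A $ a $ b) = A $ k $ b" for b
    proof -
      have "(\<Sum>a\<in>UNIV. cnj (?G $ a $ k) * A $ a $ b) = (\<Sum>a\<in>UNIV. if a = k then A $ a $ b else 0)"
        by (intro sum.cong) (use that in \<open>auto simp: rotation_def\<close>)
      then show ?thesis by simp
    qed
    have "(\<Sum>b\<in>UNIV. A $ k $ b * ?G $ b $ k) = (\<Sum>b\<in>UNIV. if b = k then A $ k $ b else 0)"
      by (intro sum.cong) (use that in \<open>auto simp: rotation_def\<close>)
    then show ?thesis unfolding D_def DG 1 by simp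
  qed
qed

definition diag :: "('q \<Rightarrow> real) \<Rightarrow> complex^'q^'q" where
  "diag l = (\<chi> i j. if i = j then of_real (l i) else 0)"

text \<open>
  A unitary \<open>u\<close> maximising \<open>\<Sum>\<^sub>k c\<^sub>k (u\<^sup>* H u)\<^sub>k\<^sub>k\<close> with strictly decreasing weights diagonalises
  \<open>H\<close>: a nonzero entry \<open>(i, j)\<close> would allow a rotation that moves mass to the diagonal entry of
  larger weight.  The quarter turn shows that the diagonal is sorted.
\<close>

theorem spectral_theorem:
  fixes H :: "('q::{finite,linorder}) cmat"
  assumes "ctransp H = H"
  obtains u l where "u \<in> unitary_group" "H = u ** diag l ** ctransp u" "\<And>i j. i \<le> j \<Longrightarrow> l j \<le> l i"
proof -
  define f where
    "f u = (\<Sum>k\<in>UNIV. - real (idx k) * Re ((ctransp u ** H ** u) $ k $ k))" for u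
  have "continuous_on unitary_group f"
    unfolding f_def by (intro continuous_intros)
  moreover have "mat 1 \<in> (unitary_group :: ('q cmat) set)"
    by (simp add: unitary_group_def ctransp_mat)
  ultimately obtain u where u: "u \<in> unitary_group" and max: "\<And>v. v \<in> unitary_group \<Longrightarrow> f v \<le> f u"
    using continuous_attains_sup[OF compact_unitary_group] by blast
  define A where "A = ctransp u ** H ** u"
  have hermA: "ctransp A = A"
    by (simp add: A_def ctransp_mult assms matrix_mul_assoc)
  have key: "(norm s)\<^sup>2 * (Re (A $ j $ j) - Re (A $ i $ i)) + 2 * c * Re (s * A $ i $ j) \<le> 0" (is "?e \<le> 0")
    if "i < j" "c\<^sup>2 + (norm s)\<^sup>2 = 1" for i j c s
  proof -
    have ne: "i \<noteq> j" using that by simp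
    let ?D = "\<lambda>k. Re ((ctransp (rotation i j c s) ** A ** rotation i j c s) $ k $ k)"
    note D = rotation_diagonal[OF ne that(2) hermA]
    have "f (u ** rotation i j c s) \<le> f u"
      by (intro max unitary_mult u rotation_unitary ne that)
    moreover have "f (u ** rotation i j c s) = (\<Sum>k\<in>UNIV. - real (idx k) * ?D k)"
      by (simp add: f_def A_def ctransp_mult matrix_mul_assoc)
    moreover have "f u = (\<Sum>k\<in>UNIV. - real (idx k) * Re (A $ k $ k))"
      by (simp add: f_def A_def)
    ultimately have "(\<Sum>k\<in>UNIV. - real (idx k) * (?D k - Re (A $ k $ k))) \<le> 0"
      by (simp add: algebra_simps sum_subtractf sum_negf)
    moreover have "(\<Sum>k\<in>UNIV. - real (idx k) * (?D k - Re (A $ k $ k)))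
        = - real (idx i) * (?D i - Re (A $ i $ i)) + - real (idx j) * (?D j - Re (A $ j $ j))"
      by (intro sum_supported_on_two ne) (use D(3) in simp)
    ultimately have "(real (idx j) - real (idx i)) * ?e \<le> 0"
      by (simp only: D(1,2)) (simp add: algebra_simps)
    moreover have "real (idx j) - real (idx i) > 0"
      using strict_mono_idx[OF that(1)] by simp
    ultimately show ?thesis
      by (simp add: mult_le_0_iff)
  qed
  have sorted: "Re (A $ j $ j) \<le> Re (A $ i $ i)" if "i < j" for i j
    using key[OF that, of 0 1] by simp
  have off: "A $ i $ j = 0" if "i < j" for i j
  proof (rule ccontr)
    assume "A $ i $ j \<noteq> 0"
    define a where "a = norm (A $ i $ j)"
    define d where "d = Re (A $ i $ i) - Re (A $ j $ j)"
    define n where "n = sqrt ((d + a)\<^sup>2 + a\<^sup>2)"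
    have a: "a > 0" using \<open>A $ i $ j \<noteq> 0\<close> by (simp add: a_def)
    have d: "d \<ge> 0" using sorted[OF that] by (simp add: d_def)
    have n2: "n\<^sup>2 = (d + a)\<^sup>2 + a\<^sup>2" by (simp add: n_def)
    have n: "n > 0" unfolding n_def using a by (simp add: add_nonneg_pos)
    \<comment> \<open>The phase of \<open>s\<close> makes the mixed term positive, and the angle lets it outweigh the quadratic one.\<close>
    define c where "c = (d + a) / n"
    define s where "s = cnj (A $ i $ j) / of_real n"
    have ns: "norm s = a / n" using n by (simp add: s_def a_def norm_divide)
    have "s * A $ i $ j = of_real (a\<^sup>2 / n)"
      by (simp add: s_def a_def complex_norm_square[unfolded of_real_power] mult.commute)
    then have re: "Re (s * A $ i $ j) = a\<^sup>2 / n" by (simp del: of_real_divide of_real_power)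
    have "c\<^sup>2 + (norm s)\<^sup>2 = 1"
      unfolding ns c_def power_divide add_divide_distrib[symmetric] n2[symmetric] using n by simp
    from key[OF that this] have "(a / n)\<^sup>2 * (- d) + 2 * c * (a\<^sup>2 / n) \<le> 0"
      unfolding re ns by (simp add: d_def)
    moreover have "(a / n)\<^sup>2 * (- d) + 2 * c * (a\<^sup>2 / n) = (a\<^sup>2 * (- d) + 2 * (d + a) * a\<^sup>2) / n\<^sup>2"
      using n by (simp add: c_def power2_eq_square field_simps)
    ultimately have "(a\<^sup>2 * (- d) + 2 * (d + a) * a\<^sup>2) / n\<^sup>2 \<le> 0" by simp
    then have "a\<^sup>2 * (- d) + 2 * (d + a) * a\<^sup>2 \<le> 0"
      using n by (simp add: divide_le_0_iff)
    moreover have "a\<^sup>2 * (- d) + 2 * (d + a) * a\<^sup>2 = a\<^sup>2 * (d + 2 * a)"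
      by (simp add: algebra_simps)
    moreover have "a\<^sup>2 * (d + 2 * a) > 0" using a d by simp
    ultimately show False by linarith
  qed
  define l where "l k = Re (A $ k $ k)" for k
  have "A = diag l"
  proof -
    have "A $ i $ j = diag l $ i $ j" for i j
    proof (cases i j rule: linorder_cases)
      case less
      then show ?thesis using off[OF less] by (simp add: diag_def)
    next
      case equal
      have "cnj (A $ j $ j) = A $ j $ j" using hermA by (metis ctransp_nth)
      then show ?thesis using equal by (simp add: diag_def l_def complex_eq_iff)
    next
      case greater
      have "A $ i $ j = cnj (A $ j $ i)" using hermA by (metis ctransp_nth)
      then show ?thesis using off[OF greater] greater by (auto simp: diag_def)
    qed
    then show ?thesis by (simp add: vec_eq_iff)
  qed
  then have "H = u ** diag l ** ctransp u"
  proof -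
    have "u ** A ** ctransp u = (u ** ctransp u) ** H ** (u ** ctransp u)"
      by (simp only: A_def matrix_mul_assoc)
    then show ?thesis using u \<open>A = diag l\<close> by (simp add: unitary_group_def)
  qed
  moreover have "l j \<le> l i" if "i \<le> j" for i j
    using sorted[of i j] that by (cases "i = j") (auto simp: l_def)
  ultimately show thesis using that u by blast
qed

section \<open>Square roots in the cone\<close>

lemma Pi_cone_congruence:
  fixes A C :: "complex^'q^'q"
  assumes "A \<in> Pi_cone"
  shows "C ** A ** ctransp C \<in> Pi_cone"
proof -
  have "v \<bullet> ((C ** A ** ctransp C) *v v) = (ctransp C *v v) \<bullet> (A *v (ctransp C *v v))" for v
    by (simp only: matrix_vector_mul_assoc[symmetric] inner_matrix_vector_mult[of v])
  then show ?thesis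
    using assms by (simp add: Pi_cone_iff ctransp_mult matrix_mul_assoc)
qed

lemma Pi_cone_add: "A \<in> Pi_cone \<Longrightarrow> B \<in> Pi_cone \<Longrightarrow> A + B \<in> Pi_cone"
  by (simp add: Pi_cone_iff ctransp_add matrix_vector_mult_add_rdistrib inner_add_right)

lemma Pi_cone_scaleR: "0 \<le> t \<Longrightarrow> A \<in> Pi_cone \<Longrightarrow> t *\<^sub>R A \<in> Pi_cone"
  by (simp add: Pi_cone_iff ctransp_scaleR scaleR_matrix_vector_mult)

lemma gram_in_Pi_cone: "A ** ctransp A \<in> (Pi_cone :: (complex^'q^'q) set)"
proof -
  have "mat 1 \<in> (Pi_cone :: (complex^'q^'q) set)" by (simp add: Pi_cone_iff ctransp_mat)
  from Pi_cone_congruence[OF this, of A] show ?thesis by simp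
qed

lemma Pi_cone_square: "S \<in> Pi_cone \<Longrightarrow> S ** S \<in> Pi_cone"
  by (metis Pi_cone_hermitian gram_in_Pi_cone)

lemma inner_psd_square: "S \<in> Pi_cone \<Longrightarrow> v \<bullet> ((S ** S) *v v) = (norm ((S :: complex^'q^'q) *v v))\<^sup>2"
  using inner_gram[of v S] by (simp add: Pi_cone_hermitian)

lemma closed_Pi_cone: "closed (Pi_cone :: (complex^'q^'q) set)"
proof -
  have "closed {A :: complex^'q^'q. ctransp A = A}"
    by (intro closed_Collect_eq continuous_intros)
  moreover have "closed {A :: complex^'q^'q. 0 \<le> v \<bullet> (A *v v)}" for v
    by (intro closed_Collect_le continuous_intros)
  ultimately have "closed ({A :: complex^'q^'q. ctransp A = A} \<inter> (\<Inter>v. {A. 0 \<le> v \<bullet> (A *v v)}))"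
    by (intro closed_Int closed_INT) auto
  moreover have "Pi_cone = {A :: complex^'q^'q. ctransp A = A} \<inter> (\<Inter>v. {A. 0 \<le> v \<bullet> (A *v v)})"
    by (auto simp: Pi_cone_iff)
  ultimately show ?thesis by simp
qed

lemma diag_nth: "diag l $ i $ j = (if i = j then of_real (l i) else 0)"
  by (simp add: diag_def)

lemma diag_vector_mult_nth: "(diag l *v x) $ i = of_real (l i) * x $ i"
  by (simp add: matrix_vector_mult_def diag_nth mult_delta_left)

lemma diag_mult: "diag l ** diag m = (diag (\<lambda>i. l i * m i) :: complex^'q^'q)"
  by (simp add: vec_eq_iff matrix_matrix_mult_def diag_nth mult_delta_left)

lemma diag_mult_nth: "(diag l ** A) $ i $ j = of_real (l i) * (A :: complex^'q^'q) $ i $ j"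
  by (simp add: matrix_matrix_mult_def diag_nth mult_delta_left)

lemma mult_diag_nth: "(A ** diag l) $ i $ j = (A :: complex^'q^'q) $ i $ j * of_real (l j)"
  by (simp add: matrix_matrix_mult_def diag_nth mult_delta_right)

lemma ctransp_diag [simp]: "ctransp (diag l) = diag l"
  by (auto simp: vec_eq_iff diag_nth)

lemma diag_in_Pi_cone: "(\<And>i. 0 \<le> l i) \<Longrightarrow> diag l \<in> Pi_cone"
  by (simp add: Pi_cone_iff inner_vec_def diag_vector_mult_nth)
    (auto intro!: sum_nonneg simp: inner_complex_def algebra_simps zero_le_mult_iff)

lemma diag_axis: "diag l *v axis k 1 = (l k) *\<^sub>R (axis k 1 :: complex^'q)"
  by (auto simp: vec_eq_iff diag_vector_mult_nth axis_def scaleR_conv_of_real[where 'a=complex])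

lemma diagonalised_eigenvector:
  assumes "u \<in> unitary_group" "H = u ** diag l ** ctransp u"
  shows "H *v (u *v axis k 1) = l k *\<^sub>R (u *v axis k 1)" "norm (u *v axis k 1) = 1"
proof -
  have "H ** u = u ** diag l"
    using assms by (simp add: unitary_cancel)
  then have "H *v (u *v axis k 1) = u *v (diag l *v axis k 1)"
    by (simp add: matrix_vector_mul_assoc)
  then show "H *v (u *v axis k 1) = l k *\<^sub>R (u *v axis k 1)"
    by (simp add: diag_axis matrix_vector_mult_scaleR)
  have "(norm (u *v axis k 1))\<^sup>2 = (axis k 1 :: complex^'a) \<bullet> axis k 1"
    using assms(1) by (simp only: inner_gram[symmetric]) (simp add: unitary_group_def)
  then show "norm (u *v axis k 1) = 1"
    by (simp add: power2_norm_eq_inner[symmetric] power2_eq_1_iff) (smt (verit) norm_ge_zero)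
qed

lemma diagonalised_nonneg:
  assumes "u \<in> unitary_group" "H = u ** diag l ** ctransp u" "H \<in> Pi_cone"
  shows "0 \<le> l k"
proof -
  let ?x = "u *v axis k 1"
  have "0 \<le> ?x \<bullet> (H *v ?x)" by (rule Pi_cone_form_nonneg[OF assms(3)])
  also have "\<dots> = l k"
    by (simp add: diagonalised_eigenvector[OF assms(1,2)] power2_norm_eq_inner[symmetric])
  finally show ?thesis .
qed

lemma psd_square_root_exists:
  fixes A :: "('q::{finite,linorder}) cmat"
  assumes "A \<in> Pi_cone"
  obtains S where "S \<in> Pi_cone" "S ** S = A"
proof -
  obtain u l where u: "u \<in> unitary_group" and A: "A = u ** diag l ** ctransp u"
    using spectral_theorem[OF Pi_cone_hermitian[OF assms]] by metis
  have l: "0 \<le> l k" for k by (rule diagonalised_nonneg[OF u A assms])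
  define S where "S = u ** diag (\<lambda>k. sqrt (l k)) ** ctransp u"
  have "S \<in> Pi_cone" unfolding S_def
    by (intro Pi_cone_congruence diag_in_Pi_cone) (simp add: l)
  moreover have "S ** S = u ** diag (\<lambda>k. sqrt (l k)) ** (ctransp u ** u) ** diag (\<lambda>k. sqrt (l k)) ** ctransp u"
    by (simp add: S_def matrix_mul_assoc)
  then have "S ** S = u ** (diag (\<lambda>k. sqrt (l k)) ** diag (\<lambda>k. sqrt (l k))) ** ctransp u"
    using u by (simp add: unitary_cancel matrix_mul_assoc)
  then have "S ** S = A" by (simp add: diag_mult l A)
  ultimately show thesis by (rule that)
qed

text \<open>
  If \<open>S\<^sup>2 = T\<^sup>2\<close> then \<open>K = S - T\<close> satisfies \<open>S K + K T = 0\<close>.  For a unit eigenvector \<open>x\<close> of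
  \<open>K\<close> with eigenvalue \<open>\<mu>\<close> this gives \<open>\<mu> (x\<^sup>* S x + x\<^sup>* T x) = 0\<close>, and \<open>\<mu> \<noteq> 0\<close> would force both
  terms, hence \<open>\<mu> = x\<^sup>* K x\<close>, to vanish.
\<close>

lemma psd_square_root_unique:
  fixes S T :: "('q::{finite,linorder}) cmat"
  assumes S: "S \<in> Pi_cone" and T: "T \<in> Pi_cone" and eq: "S ** S = T ** T"
  shows "S = T"
proof -
  define K where "K = S - T"
  have herm: "ctransp K = K"
    using S T by (simp add: K_def ctransp_diff Pi_cone_hermitian)
  obtain u l where u: "u \<in> unitary_group" and K: "K = u ** diag l ** ctransp u"
    using spectral_theorem[OF herm] by metis
  have SKT: "S ** K + K ** T = 0"
    using eq by (simp add: K_def matrix_mult_diff_left matrix_mult_diff_right)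
  have "l k = 0" for k
  proof (rule ccontr)
    assume "l k \<noteq> 0"
    define x where "x = u *v axis k 1"
    have Kx: "K *v x = l k *\<^sub>R x" and nx: "norm x = 1"
      unfolding x_def by (rule diagonalised_eigenvector[OF u K])+
    have "0 = x \<bullet> ((S ** K + K ** T) *v x)" by (simp add: SKT)
    also have "\<dots> = x \<bullet> (S *v (K *v x)) + x \<bullet> (K *v (T *v x))"
      by (simp add: matrix_vector_mult_add_rdistrib inner_add_right matrix_vector_mul_assoc)
    also have "\<dots> = l k * (x \<bullet> (S *v x) + x \<bullet> (T *v x))"
      by (simp add: inner_matrix_vector_mult[of x K] herm Kx matrix_vector_mult_scaleR algebra_simps)
    finally have "x \<bullet> (S *v x) + x \<bullet> (T *v x) = 0" using \<open>l k \<noteq> 0\<close> by simp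
    moreover have "0 \<le> x \<bullet> (S *v x)" "0 \<le> x \<bullet> (T *v x)"
      using S T by (auto intro: Pi_cone_form_nonneg)
    moreover have "l k = x \<bullet> (K *v x)" 
      using nx by (simp add: Kx power2_norm_eq_inner[symmetric])
    then have "l k = x \<bullet> (S *v x) - x \<bullet> (T *v x)"
      by (simp add: K_def matrix_vector_mult_diff_rdistrib inner_diff_right)
    ultimately show False using \<open>l k \<noteq> 0\<close> by linarith
  qed
  then have "diag l = 0" by (simp add: vec_eq_iff diag_nth)
  then have "K = 0" by (simp add: K)
  then show ?thesis by (simp add: K_def)
qed

lemma msqrt_eqI:
  fixes S :: "('q::{finite,linorder}) cmat"
  assumes "S \<in> Pi_cone" "S ** S = A"
  shows "msqrt A = S"
  unfolding msqrt_def using assms psd_square_root_unique by (intro the_equality) auto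

lemma msqrt_in_Pi_cone:
  fixes A :: "('q::{finite,linorder}) cmat"
  shows "A \<in> Pi_cone \<Longrightarrow> msqrt A \<in> Pi_cone"
  by (metis msqrt_eqI psd_square_root_exists)

lemma msqrt_square:
  fixes A :: "('q::{finite,linorder}) cmat"
  shows "A \<in> Pi_cone \<Longrightarrow> msqrt A ** msqrt A = A"
  by (metis msqrt_eqI psd_square_root_exists)

lemma msqrt_outside_Pi_cone:
  fixes A :: "complex^'q^'q"
  assumes "A \<notin> Pi_cone"
  shows "msqrt A = (THE S. False)"
proof -
  have "(\<lambda>S. S \<in> Pi_cone \<and> S ** S = A) = (\<lambda>S. False)"
    using assms Pi_cone_square by blast
  then show ?thesis unfolding msqrt_def by simp
qed

text \<open>This makes squaring a proper map on the cone.\<close>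

lemma norm_psd_square: "S \<in> Pi_cone \<Longrightarrow> (norm (S :: complex^'q^'q))\<^sup>2 = Re (trace (S ** S))"
  using trace_gram[of S] by (simp add: Pi_cone_hermitian)

text \<open>
  Squaring is injective, continuous and proper on the closed cone, so its inverse is continuous:
  on the image of a compact part of the cone this is the general fact on continuous bijections of
  compact sets, and a convergent sequence has its square roots in such a part.
\<close>

lemma continuous_on_msqrt:
  "continuous_on Pi_cone (msqrt :: ('q::{finite,linorder}) cmat \<Rightarrow> _)"
  unfolding continuous_on_sequentially
proof (intro allI ballI impI, elim conjE)
  fix x :: "nat \<Rightarrow> 'q cmat" and a
  assume a: "a \<in> Pi_cone" and x: "\<forall>n. x n \<in> Pi_cone" and lim: "x \<longlonglongrightarrow> a"
  have "(\<lambda>n. Re (trace (x n))) \<longlonglongrightarrow> Re (trace a)"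
    using lim unfolding trace_def by (intro tendsto_intros)
  then have "bounded (range (\<lambda>n. Re (trace (x n))))" by (rule convergent_imp_bounded)
  then obtain c where c: "\<And>n. \<bar>Re (trace (x n))\<bar> \<le> c"
    unfolding bounded_iff by auto
  define R where "R = sqrt (max c (Re (trace a)))"
  define K where "K = Pi_cone \<inter> cball (0 :: 'q cmat) R"
  define sq where "sq = (\<lambda>S :: 'q cmat. S ** S)"
  have "compact K"
    unfolding K_def by (intro closed_Int_compact closed_Pi_cone compact_cball)
  moreover have "continuous_on K sq" unfolding sq_def by (intro continuous_intros)
  ultimately have cont: "continuous_on (sq ` K) msqrt"
    by (intro continuous_on_inv) (auto simp: K_def sq_def intro: msqrt_eqI)
  have mem: "A \<in> sq ` K" if A: "A \<in> Pi_cone" "Re (trace A) \<le> max c (Re (trace a))" for A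
  proof -
    have "(norm (msqrt A))\<^sup>2 = Re (trace A)"
      using A by (simp add: norm_psd_square msqrt_in_Pi_cone msqrt_square)
    then have "norm (msqrt A) \<le> R"
      unfolding R_def using A by (intro real_le_rsqrt) simp
    then have "msqrt A \<in> K" using A by (simp add: K_def msqrt_in_Pi_cone)
    then show ?thesis using msqrt_square[OF A(1)] by (force simp: sq_def)
  qed
  have "a \<in> sq ` K" by (rule mem) (use a in auto)
  moreover have "x n \<in> sq ` K" for n
    by (rule mem) (use x c[of n] in \<open>auto simp: abs_le_iff max_def\<close>)
  ultimately show "(msqrt \<circ> x) \<longlonglongrightarrow> msqrt a"
    using cont lim unfolding continuous_on_sequentially by blast
qed

text \<open>
  Outside the cone no positive semidefinite square root exists, so \<^const>\<open>msqrt\<close> takes one constant default value there.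
\<close>

lemma borel_measurable_msqrt:
  "(msqrt :: ('q::{finite,linorder}) cmat \<Rightarrow> _) \<in> borel_measurable borel"
proof -
  have "(\<lambda>A :: 'q cmat.
      if A \<in> Pi_cone then msqrt A else (THE S. False)) \<in> borel_measurable borel"
    by (intro borel_measurable_continuous_on_if borel_closed closed_Pi_cone continuous_on_msqrt
        continuous_on_const)
  moreover have "(\<lambda>A :: 'q cmat.
      if A \<in> Pi_cone then msqrt A else (THE S. False)) = msqrt"
    by (rule ext) (simp add: msqrt_outside_Pi_cone)
  ultimately show ?thesis by simp
qed

section \<open>The ball of strict contractions and its defect determinant\<close>

lemma B_ball_mult_contraction:
  fixes w C :: "complex^'q^'q"
  assumes "w \<in> B_ball" "\<And>v. norm (C *v v) \<le> norm v"
  shows "w ** C \<in> B_ball"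
  unfolding B_ball_iff
proof (intro allI impI)
  fix v :: "complex^'q" assume "v \<noteq> 0"
  show "norm ((w ** C) *v v) < norm v"
  proof (cases "C *v v = 0")
    case True
    then show ?thesis using \<open>v \<noteq> 0\<close> by (simp add: matrix_vector_mul_assoc[symmetric])
  next
    case False
    then have "norm (w *v (C *v v)) < norm (C *v v)" using assms(1) by (simp add: B_ball_iff)
    also have "\<dots> \<le> norm v" by (rule assms(2))
    finally show ?thesis by (simp add: matrix_vector_mul_assoc)
  qed
qed

lemma norm_diag_mult_le:
  assumes "\<And>k. \<bar>l k\<bar> \<le> 1"
  shows "norm (diag l *v (v :: complex^'q)) \<le> norm v"
  unfolding norm_vec_def
proof (rule L2_set_mono)
  fix i
  have "\<bar>l i\<bar> * norm (v $ i) \<le> 1 * norm (v $ i)" by (intro mult_right_mono assms) simp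
  then show "norm ((diag l *v v) $ i) \<le> norm (v $ i)" by (simp add: diag_vector_mult_nth norm_mult)
qed simp

lemma zero_in_B_ball: "0 \<in> B_ball"
  by (simp add: B_ball_iff)

lemma open_B_ball: "open (B_ball :: (complex^'q^'q) set)"
  unfolding open_dist
proof (intro ballI)
  fix w :: "complex^'q^'q" assume w: "w \<in> B_ball"
  have "sphere (0 :: complex^'q) 1 \<noteq> {}" by simp
  moreover have "continuous_on (sphere (0 :: complex^'q) 1) (\<lambda>v. norm (w *v v))"
    by (intro continuous_intros)
  ultimately obtain x where x: "x \<in> sphere 0 1"
    and max: "\<And>v. v \<in> sphere 0 1 \<Longrightarrow> norm (w *v v) \<le> norm (w *v x)"
    using continuous_attains_sup[OF compact_sphere] by metis
  define m where "m = norm (w *v x)"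
  have "m < norm x" using w x unfolding B_ball_iff m_def by (metis dist_0_norm mem_sphere norm_zero zero_neq_one)
  then have "m < 1" using x by simp
  have wle: "norm (w *v v) \<le> m * norm v" for v
  proof (cases "v = 0")
    case False
    then have "norm (w *v ((1 / norm v) *\<^sub>R v)) \<le> m" unfolding m_def by (intro max) simp
    then show ?thesis using False by (simp add: matrix_vector_mult_scaleR field_simps)
  qed simp
  show "\<exists>e>0. \<forall>y. dist y w < e \<longrightarrow> y \<in> B_ball"
  proof (intro exI[of _ "1 - m"] conjI allI impI)
    fix y assume "dist y w < 1 - m"
    then have d: "norm (y - w) < 1 - m" by (simp add: dist_norm)
    show "y \<in> B_ball" unfolding B_ball_iff
    proof (intro allI impI)
      fix v :: "complex^'q" assume "v \<noteq> 0"
      have "y *v v = w *v v + (y - w) *v v" by (simp add: matrix_vector_mult_diff_rdistrib)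
      then have "norm (y *v v) \<le> norm (w *v v) + norm ((y - w) *v v)" by (metis norm_triangle_ineq)
      also have "\<dots> \<le> m * norm v + norm (y - w) * norm v"
        by (intro add_mono wle norm_matrix_vector_mult_le)
      also have "\<dots> < m * norm v + (1 - m) * norm v"
        using d \<open>v \<noteq> 0\<close> by (intro add_strict_left_mono mult_strict_right_mono) auto
      finally show "norm (y *v v) < norm v" by (simp add: algebra_simps)
    qed
  qed (use \<open>m < 1\<close> in simp)
qed

lemma bounded_B_ball: "bounded (B_ball :: (complex^'q^'q) set)"
proof (rule boundedI)
  fix w :: "complex^'q^'q" assume w: "w \<in> B_ball"
  have entry: "norm (w $ i $ j) \<le> 1" for i j
  proof -
    have "norm ((w *v axis j 1) $ i) \<le> norm (w *v axis j 1)" by (rule Finite_Cartesian_Product.norm_nth_le)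
    also have "\<dots> < norm (axis j (1 :: complex))"
      using w[unfolded B_ball_iff, rule_format, of "axis j 1"] by (simp add: axis_eq_0_iff)
    finally show ?thesis by (simp add: mult_axis_nth)
  qed
  have "norm w \<le> (\<Sum>i\<in>UNIV. norm (w $ i))"
    unfolding norm_vec_def[of w] by (rule L2_set_le_sum) simp
  also have "\<dots> \<le> (\<Sum>i\<in>UNIV. \<Sum>j\<in>UNIV. norm (w $ i $ j))"
    by (intro sum_mono) (simp add: norm_vec_def L2_set_le_sum)
  also have "\<dots> \<le> (\<Sum>i\<in>(UNIV :: 'q set). \<Sum>j\<in>(UNIV :: 'q set). 1)"
    by (intro sum_mono entry)
  finally show "norm w \<le> real (CARD('q) * CARD('q))" by simp
qed

text \<open>
  The base of the power in the weight; on the ball it lies in \<open>(0, 1]\<close>, because the eigenvalues of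
  \<open>I - w\<^sup>* w\<close> at unit eigenvectors \<open>x\<close> are \<open>1 - \<parallel>w x\<parallel>\<^sup>2\<close>.
\<close>

definition defect :: "complex^'q^'q \<Rightarrow> complex" where
  "defect w = det (mat 1 - ctransp w ** w)"

lemma det_diag: "det (diag l) = of_real (\<Prod>i\<in>UNIV. l i)"
  by (subst det_diagonal) (simp_all add: diag_nth)

lemma defect_pos_le_1:
  fixes w :: "('q::{finite,linorder}) cmat"
  assumes "w \<in> B_ball"
  shows "0 < Re (defect w)" "Re (defect w) \<le> 1"
proof -
  define H where "H = mat 1 - ctransp w ** w"
  have "ctransp H = H" by (simp add: H_def ctransp_diff ctransp_mat ctransp_mult)
  then obtain u l where u: "u \<in> unitary_group" and H: "H = u ** diag l ** ctransp u"
    using spectral_theorem by metis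
  have l: "0 < l k" "l k \<le> 1" for k
  proof -
    define x where "x = u *v axis k 1"
    have Hx: "H *v x = l k *\<^sub>R x" and nx: "norm x = 1"
      unfolding x_def by (rule diagonalised_eigenvector[OF u H])+
    have "l k = x \<bullet> (H *v x)" using nx by (simp add: Hx power2_norm_eq_inner[symmetric])
    also have "\<dots> = 1 - (norm (w *v x))\<^sup>2"
      using nx by (simp add: H_def matrix_vector_mult_diff_rdistrib inner_diff_right inner_gram power2_norm_eq_inner[symmetric])
    finally have lk: "l k = 1 - (norm (w *v x))\<^sup>2" .
    have "x \<noteq> 0" using nx by auto
    then have "norm (w *v x) < 1" using assms nx unfolding B_ball_iff by metis
    then have "(norm (w *v x))\<^sup>2 < 1" by (simp add: abs_square_less_1)
    then show "0 < l k" "l k \<le> 1" using lk by auto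
  qed
  have "det u * det (ctransp u) = det (u ** ctransp u)" by (simp add: det_mul)
  also have "\<dots> = 1" using u by (simp add: unitary_group_def)
  finally have "defect w = of_real (\<Prod>i\<in>UNIV. l i)"
    by (simp add: defect_def H_def[symmetric] H det_mul det_diag mult.assoc mult.left_commute)
  moreover have "0 < (\<Prod>i\<in>UNIV. l i)" using l by (intro prod_pos) auto
  moreover have "(\<Prod>i\<in>UNIV. l i) \<le> 1" using l by (intro prod_le_1) (auto simp: less_imp_le)
  ultimately show "0 < Re (defect w)" "Re (defect w) \<le> 1" by (simp_all del: of_real_prod)
qed

definition colscale :: "'q \<Rightarrow> real \<Rightarrow> complex^'q^'q" where
  "colscale j c = diag (\<lambda>k. if k = j then c else 1)"

lemma colscale_1: "colscale j 1 = (mat 1 :: complex^'q^'q)"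
  by (simp add: vec_eq_iff colscale_def diag_nth mat_def)

lemma continuous_on_defect [continuous_intros]:
  fixes f :: "'a::topological_space \<Rightarrow> complex^'q^'q"
  shows "continuous_on S f \<Longrightarrow> continuous_on S (\<lambda>x. defect (f x))"
  unfolding defect_def by (intro continuous_intros)

lemma continuous_on_colscale [continuous_intros]: "continuous_on S (\<lambda>c. colscale j c :: complex^'q^'q)"
proof -
  have "continuous_on S (\<lambda>c. if a = b then of_real (if a = j then c else 1) else (0 :: complex))" for a b :: 'q
    by (cases "a = b"; cases "a = j") (auto intro!: continuous_intros)
  then show ?thesis
    unfolding colscale_def diag_def by (intro continuous_on_vec_lambda)
qed

text \<open>
  Writing \<open>I - S X S = S (S\<^sup>-\<^sup>2 - X) S\<close> for \<open>S = colscale j c\<close> and expanding row \<open>j\<close> of the middle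
  factor shows that the determinant is affine in \<open>c\<^sup>2\<close>; the value \<open>c = 0\<close> follows by continuity.
\<close>

lemma defect_colscale_affine:
  fixes w :: "complex^'q^'q"
  obtains b where "\<And>c. defect (w ** colscale j c) = defect (w ** colscale j 0) + of_real (c\<^sup>2) * b"
proof -
  define X where "X = ctransp w ** w"
  define E where "E = (\<chi> i. if i = j then axis j 1 else (mat 1 - X) $ i)"
  define F where "F = (\<chi> i. if i = j then - X $ j else (mat 1 - X) $ i)"
  have ne: "defect (w ** colscale j c) = det E + of_real (c\<^sup>2) * det F" if c: "c \<noteq> 0" for c
  proof -
    define S where "S = (colscale j c :: complex^'q^'q)"
    define M where "M = (\<chi> i. if i = j then of_real (1 / c\<^sup>2) *s axis j 1 + (- X $ j) else (mat 1 - X) $ i)"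
    have "mat 1 - ctransp (w ** S) ** (w ** S) = S ** M ** S"
    proof -
      have SXS: "(ctransp (w ** S) ** (w ** S)) = S ** X ** S"
        by (simp add: ctransp_mult X_def matrix_mul_assoc S_def colscale_def)
      have "(mat 1 - S ** X ** S) $ a $ b = (S ** M ** S) $ a $ b" for a b
        using c unfolding S_def colscale_def
        by (simp add: diag_mult_nth mult_diag_nth M_def)
          (auto simp: mat_def axis_def field_simps power2_eq_square)
      then show ?thesis by (simp add: SXS vec_eq_iff)
    qed
    then have "defect (w ** S) = det S * det M * det S" by (simp add: defect_def det_mul)
    moreover have "det S = of_real c"
      unfolding S_def colscale_def det_diag by (simp add: prod.delta)
    moreover have "det M = of_real (1 / c\<^sup>2) * det E + det F"
      unfolding M_def E_def F_def by (simp add: det_row_add det_row_mul)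
    ultimately have "defect (w ** S) = of_real c * (of_real (1 / c\<^sup>2) * det E + det F) * of_real c"
      by simp
    also have "\<dots> = det E + of_real (c\<^sup>2) * det F"
      using c by (simp add: field_simps power2_eq_square)
    finally show ?thesis by (simp add: S_def)
  qed
  have zero: "defect (w ** colscale j 0) = det E"
  proof (rule tendsto_unique)
    have "continuous_on UNIV (\<lambda>c. defect (w ** colscale j c))" by (intro continuous_intros)
    then show "((\<lambda>c. defect (w ** colscale j c)) \<longlongrightarrow> defect (w ** colscale j 0)) (at 0)"
      by (simp add: continuous_on_def)
    have "((\<lambda>c. det E + of_real (c\<^sup>2) * det F) \<longlongrightarrow> det E + of_real (0\<^sup>2) * det F) (at 0)"
      by (intro tendsto_intros)
    then have "((\<lambda>c. det E + of_real (c\<^sup>2) * det F) \<longlongrightarrow> det E) (at 0)" by simp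
    then show "((\<lambda>c. defect (w ** colscale j c)) \<longlongrightarrow> det E) (at 0)"
      by (rule Lim_transform_eventually) (auto simp: eventually_at_filter ne)
  qed simp
  have "defect (w ** colscale j c) = defect (w ** colscale j 0) + of_real (c\<^sup>2) * det F" for c
    by (cases "c = 0") (simp_all add: ne zero)
  then show thesis by (rule that)
qed

definition colproj :: "'q set \<Rightarrow> complex^'q^'q" where
  "colproj J = diag (indicator J)"

text \<open>The principal minor of \<open>I - w\<^sup>* w\<close> on the index set \<open>J\<close>, as a defect determinant.\<close>

definition minor :: "'q set \<Rightarrow> complex^'q^'q \<Rightarrow> real" where
  "minor J w = Re (defect (w ** colproj J))"

lemma colproj_colscale: "colproj J ** colscale j c = (colscale j c ** colproj J :: complex^'q^'q)"
  by (simp add: colproj_def colscale_def diag_mult mult.commute)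

lemma minor_UNIV: "minor UNIV w = Re (defect w)"
proof -
  have "colproj UNIV = (mat 1 :: complex^'a^'a)"
    by (simp add: vec_eq_iff colproj_def diag_nth mat_def)
  then show ?thesis by (simp add: minor_def)
qed

lemma minor_empty: "minor {} w = 1"
proof -
  have "colproj {} = (0 :: complex^'a^'a)"
    by (simp add: vec_eq_iff colproj_def diag_nth)
  then show ?thesis by (simp add: minor_def defect_def)
qed

lemma minor_pos_le_1:
  fixes w :: "('q::{finite,linorder}) cmat"
  assumes "w \<in> B_ball"
  shows "0 < minor J w" "minor J w \<le> 1"
proof -
  have "w ** colproj J \<in> B_ball"
    unfolding colproj_def by (intro B_ball_mult_contraction assms norm_diag_mult_le) (simp add: indicator_def)
  then show "0 < minor J w" "minor J w \<le> 1"
    unfolding minor_def by (rule defect_pos_le_1)+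
qed

lemma minor_colscale:
  assumes "j \<notin> J"
  shows "minor J (w ** colscale j c) = minor J w"
proof -
  have "colscale j c ** colproj J = (colproj J :: complex^'a^'a)"
    using assms by (auto simp: vec_eq_iff colproj_def colscale_def diag_mult diag_nth indicator_def)
  then show ?thesis by (simp add: minor_def matrix_mul_assoc[symmetric])
qed

text \<open>
  If column \<open>j\<close> can be stretched by \<open>1 / \<surd>(1 - \<epsilon>)\<close> inside the ball, then adding \<open>j\<close> to the index
  set loses at most the factor \<open>\<epsilon>\<close>: the new minor is affine in the square of the stretching factor,
  is the old minor at \<open>0\<close>, and is still positive at \<open>1 / (1 - \<epsilon>)\<close>.
\<close>

lemma minor_insert_ge:
  fixes w :: "('q::{finite,linorder}) cmat"
  assumes "j \<notin> J" "0 \<le> e" "e < 1" and stretch: "w ** colscale j (1 / sqrt (1 - e)) \<in> B_ball"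
  shows "e * minor J w \<le> minor (insert j J) w"
proof -
  let ?J = "insert j J"
  define c where "c = 1 / sqrt (1 - e)"
  have c2: "c\<^sup>2 = 1 / (1 - e)" using assms by (simp add: c_def power_divide)
  obtain b where b: "\<And>c. defect (w ** colproj ?J ** colscale j c)
      = defect (w ** colproj ?J ** colscale j 0) + of_real (c\<^sup>2) * b"
    using defect_colscale_affine[of "w ** colproj ?J" j] by metis
  have "colproj ?J ** colscale j 0 = (colproj J :: 'q cmat)"
    using assms(1) by (auto simp: vec_eq_iff colproj_def colscale_def diag_mult diag_nth indicator_def)
  then have zero: "Re (defect (w ** colproj ?J ** colscale j 0)) = minor J w"
    by (simp add: minor_def matrix_mul_assoc[symmetric])
  have one: "minor ?J w = minor J w + Re b"
    using b[of 1] zero by (simp add: minor_def colscale_1)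
  have "0 < minor ?J (w ** colscale j c)"
    using stretch unfolding c_def by (rule minor_pos_le_1)
  also have "minor ?J (w ** colscale j c) = minor J w + c\<^sup>2 * Re b"
    using b[of c] zero by (simp add: minor_def matrix_mul_assoc[symmetric] colproj_colscale del: of_real_power)
  finally have "0 < minor J w + Re b / (1 - e)" by (simp add: c2)
  then have "0 < (1 - e) * minor J w + Re b"
    using assms by (simp add: field_simps)
  then show ?thesis using one by (simp add: algebra_simps)
qed

section \<open>Integrability of the weight\<close>

text \<open>
  Scaling one column is a diagonal map in the standard real basis, so it multiplies Lebesgue measure
  by a power of the scaling factor; the exponent is twice the number of rows.
\<close>

lemma nn_integral_colscale:
  fixes j :: "'q::finite"
  obtains m :: nat where "\<And>f c. f \<in> borel_measurable borel \<Longrightarrow> c > 0 \<Longrightarrow>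
    (\<integral>\<^sup>+w. f w \<partial>lborel) = ennreal (c ^ m) * (\<integral>\<^sup>+w. f (w ** colscale j c :: complex^'q^'q) \<partial>lborel)"
proof -
  define C where "C = {e \<in> (Basis :: (complex^'q^'q) set). \<exists>i b. e = axis i (axis j b)}"
  have fin: "finite C" by (simp add: C_def)
  have "(\<integral>\<^sup>+w. f w \<partial>lborel) = ennreal (c ^ card C) * (\<integral>\<^sup>+w. f (w ** colscale j c) \<partial>lborel)"
    if f: "f \<in> borel_measurable borel" and c: "c > 0" for f :: "complex^'q^'q \<Rightarrow> ennreal" and c
  proof -
    define s where "s e = (if e \<in> C then c else 1)" for e
    define T where "T x = 0 + (\<Sum>e\<in>Basis. (s e * (x \<bullet> e)) *\<^sub>R e)" for x :: "complex^'q^'q"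
    have T: "T x = x ** colscale j c" for x
    proof (rule euclidean_eqI)
      fix e :: "complex^'q^'q" assume e: "e \<in> Basis"
      then obtain i k b where eq: "e = axis i (axis k b)" and b: "b \<in> Basis"
        by (auto simp: Basis_vec_def)
      have "b \<noteq> 0" using b by (rule nonzero_Basis)
      then have "e \<in> C \<longleftrightarrow> k = j"
        using e unfolding C_def eq by (auto simp: axis_eq_axis axis_eq_0_iff)
      then have s: "s e = (if k = j then c else 1)" by (simp add: s_def)
      have "T x \<bullet> e = s e * (x \<bullet> e)"
        using e by (simp add: T_def inner_sum_left inner_Basis mult_delta_right)
      also have "\<dots> = (x ** colscale j c) \<bullet> e"
        unfolding s unfolding eq inner_axis
        by (simp add: colscale_def mult_diag_nth inner_complex_def algebra_simps)
      finally show "T x \<bullet> e = (x ** colscale j c) \<bullet> e" .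
    qed
    have "T \<in> borel_measurable borel"
      unfolding T by (intro borel_measurable_continuous_onI continuous_intros)
    then have [measurable]: "T \<in> measurable lborel borel" by simp
    have "lborel = density (distr lborel borel T) (\<lambda>_. (\<Prod>e\<in>Basis. \<bar>s e\<bar>))"
      unfolding T_def by (rule lborel_affine_euclidean) (use c in \<open>simp add: s_def\<close>)
    moreover have "(\<Prod>e\<in>Basis. \<bar>s e\<bar>) = c ^ card C"
    proof -
      have "(\<Prod>e\<in>Basis. \<bar>s e\<bar>) = (\<Prod>e\<in>C. \<bar>s e\<bar>)"
        by (rule prod.mono_neutral_right) (auto simp: s_def C_def)
      also have "\<dots> = (\<Prod>e\<in>C. c)" using c by (intro prod.cong) (auto simp: s_def)
      finally show ?thesis by simp
    qed
    ultimately have "(\<integral>\<^sup>+w. f w \<partial>lborel) = (\<integral>\<^sup>+w. f w \<partial>density (distr lborel borel T) (\<lambda>_. ennreal (c ^ card C)))"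
      by simp
    also have "\<dots> = ennreal (c ^ card C) * (\<integral>\<^sup>+w. f (T w) \<partial>lborel)"
      using f by (simp add: nn_integral_density nn_integral_cmult nn_integral_distr)
    finally show ?thesis by (simp add: T)
  qed
  then show thesis by (rule that)
qed

lemma measurable_B_ball [measurable]: "B_ball \<in> sets borel"
  by (rule borel_open[OF open_B_ball])

lemma continuous_on_minor: "continuous_on S (minor J :: complex^'q^'q \<Rightarrow> real)"
  unfolding minor_def[abs_def] by (intro continuous_intros)

lemma borel_measurable_minor [measurable]: "minor J \<in> borel_measurable borel"
  by (intro borel_measurable_continuous_onI continuous_on_minor)

lemma borel_measurable_mult_colscale [measurable]:
  "(\<lambda>w. w ** colscale j c :: complex^'q^'q) \<in> borel_measurable borel"
  by (intro borel_measurable_continuous_onI continuous_intros)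

lemma mult_colscale_inverse: "c \<noteq> 0 \<Longrightarrow> (w :: complex^'q^'q) ** colscale j c ** colscale j (1 / c) = w"
proof -
  assume "c \<noteq> 0"
  then have "colscale j c ** colscale j (1 / c) = (mat 1 :: complex^'q^'q)"
    by (simp add: vec_eq_iff colscale_def diag_mult diag_nth mat_def)
  then show ?thesis by (simp add: matrix_mul_assoc[symmetric])
qed

text \<open>
  The part of the ball that leaves it when column \<open>j\<close> is stretched by \<open>1 / \<surd>(1 - \<epsilon>)\<close> has relative
  mass \<open>O(\<epsilon>)\<close> for every density that does not depend on that column: by the change of variables the
  remaining part is the shrunken ball.
\<close>

lemma nn_integral_boundary_shell:
  fixes j :: "'q::{finite,linorder}" and G :: "'q cmat \<Rightarrow> ennreal"
  assumes G[measurable]: "G \<in> borel_measurable borel" and inv: "\<And>w c. G (w ** colscale j c) = G w"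
    and finI: "(\<integral>\<^sup>+w. indicator B_ball w * G w \<partial>lborel) < \<infinity>"
  obtains m :: nat where "\<And>e. 0 \<le> e \<Longrightarrow> e < 1 \<Longrightarrow>
      (\<integral>\<^sup>+w. indicator {w \<in> B_ball. w ** colscale j (1 / sqrt (1 - e)) \<notin> B_ball} w * G w \<partial>lborel)
        \<le> ennreal (real m * e) * (\<integral>\<^sup>+w. indicator B_ball w * G w \<partial>lborel)"
proof -
  obtain m where m: "\<And>f c. f \<in> borel_measurable borel \<Longrightarrow> c > 0 \<Longrightarrow>
    (\<integral>\<^sup>+w. f w \<partial>lborel) = ennreal (c ^ m) * (\<integral>\<^sup>+w. f (w ** colscale j c :: 'q cmat) \<partial>lborel)"
    using nn_integral_colscale by blast
  show thesis
  proof (rule that[of m])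
    fix e :: real
    assume e: "0 \<le> e" "e < 1"
    define c where "c = 1 / sqrt (1 - e)"
    have c: "c \<ge> 1" "c > 0" using e by (simp_all add: c_def real_sqrt_le_1_iff)
    have c2: "c\<^sup>2 = 1 / (1 - e)" using e by (simp add: c_def power_divide)
    define I K L where "I = (\<integral>\<^sup>+w. indicator B_ball w * G w \<partial>lborel)"
      and "K = (\<integral>\<^sup>+w. indicator B_ball (w ** colscale j c) * G w \<partial>lborel)"
      and "L = (\<integral>\<^sup>+w. indicator {w \<in> B_ball. w ** colscale j c \<notin> B_ball} w * G w \<partial>lborel)"
    have shrink: "w \<in> B_ball" if "w ** colscale j c \<in> B_ball" for w
    proof -
      have "w ** colscale j c ** colscale j (1 / c) \<in> B_ball"
        using c unfolding colscale_def[of _ "1 / c"]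
        by (intro B_ball_mult_contraction[OF that] norm_diag_mult_le) (simp add: field_simps)
      then show ?thesis using c by (simp add: mult_colscale_inverse)
    qed
    have IK: "I = ennreal (c ^ m) * K"
      unfolding I_def K_def by (subst m[OF _ c(2)]) (simp_all add: inv)
    have "I = (\<integral>\<^sup>+w. (indicator B_ball (w ** colscale j c) * G w
        + indicator {w \<in> B_ball. w ** colscale j c \<notin> B_ball} w * G w) \<partial>lborel)"
      unfolding I_def by (intro nn_integral_cong) (use shrink in \<open>auto simp: indicator_def\<close>)
    also have "\<dots> = K + L"
      unfolding K_def L_def by (intro nn_integral_add) measurable
    finally have IKL: "I = K + L" .
    have "I < \<infinity>" using finI by (simp add: I_def)
    then obtain k l where kl: "K = ennreal k" "L = ennreal l" "0 \<le> k" "0 \<le> l"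
      using IKL by (cases K; cases L) auto
    have I: "I = ennreal (k + l)" using kl IKL by simp
    then have eq: "k + l = c ^ m * k"
    proof -
      have "ennreal (k + l) = ennreal (c ^ m * k)"
        using IK I kl c by (simp add: ennreal_mult[symmetric])
      then show ?thesis using kl c by (subst (asm) ennreal_inj) auto
    qed
    have "1 - real m * e \<le> (1 - e) ^ m"
      using Bernoulli_inequality[of "- e" m] e by simp
    also have "\<dots> \<le> sqrt (1 - e) ^ m"
      using e by (intro power_mono) (auto intro!: real_le_rsqrt simp: power2_eq_square mult_left_le)
    also have "\<dots> = 1 / c ^ m" by (simp add: c_def power_divide)
    finally have "(1 - real m * e) * (k + l) \<le> 1 / c ^ m * (k + l)"
      using kl by (intro mult_right_mono) auto
    also have "\<dots> = k" using eq c by simp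
    finally have "l \<le> real m * e * (k + l)" by (simp add: algebra_simps)
    then have "L \<le> ennreal (real m * e * (k + l))" using kl by (simp add: ennreal_leI)
    also have "\<dots> = ennreal (real m * e) * I" using kl e by (simp add: I ennreal_mult)
    finally show "(\<integral>\<^sup>+w. indicator {w \<in> B_ball. w ** colscale j (1 / sqrt (1 - e)) \<notin> B_ball} w * G w \<partial>lborel)
        \<le> ennreal (real m * e) * (\<integral>\<^sup>+w. indicator B_ball w * G w \<partial>lborel)"
      by (simp add: L_def I_def c_def)
  qed
qed

lemma eventually_stretch_in_B_ball:
  fixes w :: "complex^'q^'q"
  assumes "w \<in> B_ball"
  shows "\<exists>k. w ** colscale j (1 / sqrt (1 - (1/2) ^ Suc k)) \<in> B_ball"
proof -
  have "(\<lambda>k. (1/2 :: real) ^ Suc k) \<longlonglongrightarrow> 0"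
    by (intro LIMSEQ_Suc LIMSEQ_realpow_zero) auto
  then have "(\<lambda>k. 1 / sqrt (1 - (1/2) ^ Suc k)) \<longlonglongrightarrow> 1 / sqrt (1 - 0)"
    by (intro tendsto_intros) auto
  then have lim: "(\<lambda>k. 1 / sqrt (1 - (1/2) ^ Suc k)) \<longlonglongrightarrow> 1" by simp
  have "continuous_on UNIV (\<lambda>c. w ** colscale j c)" by (intro continuous_intros)
  then have "isCont (\<lambda>c. w ** colscale j c) 1" by (simp add: continuous_on_eq_continuous_at)
  from isCont_tendsto_compose[OF this lim]
  have "(\<lambda>k. w ** colscale j (1 / sqrt (1 - (1/2) ^ Suc k))) \<longlonglongrightarrow> w ** colscale j 1" .
  then have "(\<lambda>k. w ** colscale j (1 / sqrt (1 - (1/2) ^ Suc k))) \<longlonglongrightarrow> w"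
    by (simp add: colscale_1)
  from topological_tendstoD[OF this open_B_ball assms] show ?thesis
    by (meson eventually_sequentially order_refl)
qed

text \<open>
  Cut the ball into the shells on which the stretching factor \<open>1 / \<surd>(1 - 2\<^sup>-\<^sup>k)\<close> is still too large
  but the next one is not.  Passing from \<open>J\<close> to \<open>insert j J\<close> there costs a factor \<open>2\<^sup>-\<^sup>k\<^sup>a\<close>, while
  the shell has relative mass \<open>O(2\<^sup>-\<^sup>k)\<close>; the resulting geometric series converges as \<open>a > -1\<close>.
\<close>

lemma minor_powr_integral_step:
  fixes j :: "'q::{finite,linorder}"
  assumes a: "-1 < a" "a < 0" and j: "j \<notin> J"
    and fin: "(\<integral>\<^sup>+w. indicator B_ball w * ennreal (minor J (w :: 'q cmat) powr a) \<partial>lborel) < \<infinity>"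
  shows "(\<integral>\<^sup>+w. indicator B_ball w * ennreal (minor (insert j J) (w :: 'q cmat) powr a) \<partial>lborel) < \<infinity>"
proof -
  define G where "G w = ennreal (minor J w powr a)" for w :: "'q cmat"
  define I where "I = (\<integral>\<^sup>+w. indicator B_ball w * G w \<partial>lborel)"
  define E where "E k = {w \<in> B_ball. k = 0 \<or> w ** colscale j (1 / sqrt (1 - (1/2) ^ k)) \<notin> B_ball}" for k :: nat
  define q where "q k = ((1/2) ^ Suc k) powr a" for k :: nat
  have [measurable]: "G \<in> borel_measurable borel" unfolding G_def by measurable
  have [measurable]: "E k \<in> sets borel" for k unfolding E_def by measurable
  have finI: "I < \<infinity>" using fin by (simp add: I_def G_def)
  have inv: "G (w ** colscale j c) = G w" for w c using j by (simp add: G_def minor_colscale)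
  obtain m where m: "\<And>e. 0 \<le> e \<Longrightarrow> e < 1 \<Longrightarrow>
      (\<integral>\<^sup>+w. indicator {w \<in> B_ball. w ** colscale j (1 / sqrt (1 - e)) \<notin> B_ball} w * G w \<partial>lborel)
        \<le> ennreal (real m * e) * I"
    using nn_integral_boundary_shell[of G j, OF _ inv] finI unfolding I_def by auto
  have shell: "(\<integral>\<^sup>+w. indicator (E k) w * G w \<partial>lborel) \<le> ennreal ((real m + 1) * (1/2) ^ k) * I" for k
  proof (cases "k = 0")
    case True
    then have "(\<integral>\<^sup>+w. indicator (E k) w * G w \<partial>lborel) = 1 * I" by (simp add: E_def I_def)
    also have "\<dots> \<le> ennreal (real m + 1) * I"
      by (intro mult_right_mono) (simp_all add: ennreal_1[symmetric] ennreal_leI del: ennreal_1)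
    finally show ?thesis using True by simp
  next
    case False
    then have "(\<integral>\<^sup>+w. indicator (E k) w * G w \<partial>lborel) \<le> ennreal (real m * (1/2) ^ k) * I"
      using m[of "(1/2) ^ k"] by (simp add: E_def power_less_one_iff power_one_over)
    also have "\<dots> \<le> ennreal ((real m + 1) * (1/2) ^ k) * I"
      by (intro mult_right_mono ennreal_leI) simp_all
    finally show ?thesis .
  qed
  have pointwise: "indicator B_ball w * ennreal (minor (insert j J) w powr a)
      \<le> (\<Sum>k. ennreal (q k) * (indicator (E k) w * G w))" for w :: "'q cmat"
  proof (cases "w \<in> B_ball")
    case True
    define P where "P k \<longleftrightarrow> w ** colscale j (1 / sqrt (1 - (1/2) ^ Suc k)) \<in> B_ball" for k :: nat
    define k where "k = (LEAST k. P k)"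
    have "\<exists>k. P k" unfolding P_def by (rule eventually_stretch_in_B_ball[OF True])
    then have Pk: "P k" and least: "\<And>i. i < k \<Longrightarrow> \<not> P i"
      unfolding k_def by (auto intro: LeastI_ex dest: not_less_Least)
    have "w \<in> E k"
      using least[of "k - 1"] True by (cases k) (auto simp: E_def P_def)
    define e :: real where "e = (1/2) ^ Suc k"
    have e: "0 < e" "e < 1" unfolding e_def by (simp, rule power_Suc_less_one) auto
    have "e * minor J w \<le> minor (insert j J) w"
      using e Pk unfolding P_def e_def[symmetric] by (intro minor_insert_ge j) auto
    moreover have "0 < minor J w" using True by (rule minor_pos_le_1)
    ultimately have "minor (insert j J) w powr a \<le> (e * minor J w) powr a"
      using a e by (intro powr_mono2') auto
    also have "\<dots> = q k * minor J w powr a"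
      using e \<open>0 < minor J w\<close> unfolding q_def e_def[symmetric] by (simp add: powr_mult)
    finally have "indicator B_ball w * ennreal (minor (insert j J) w powr a) \<le> ennreal (q k) * (indicator (E k) w * G w)"
      using True \<open>w \<in> E k\<close> by (simp add: G_def ennreal_mult[symmetric] q_def ennreal_leI)
    also have "\<dots> = (\<Sum>k\<in>{k}. ennreal (q k) * (indicator (E k) w * G w))" by simp
    also have "\<dots> \<le> (\<Sum>k. ennreal (q k) * (indicator (E k) w * G w))"
      by (rule sum_le_suminf) simp_all
    finally show ?thesis .
  qed simp
  define r where "r = (1/2 :: real) powr (1 + a)"
  have r: "0 \<le> r" "r < 1"
    using a powr_less_mono2[of "1 + a" "1/2" 1] by (auto simp: r_def)
  have qr: "q k * ((real m + 1) * (1/2) ^ k) = (1/2) powr a * (real m + 1) * r ^ k" for k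
  proof -
    have "q k = ((1/2) powr real (Suc k)) powr a"
      unfolding q_def by (subst powr_realpow) auto
    also have "\<dots> = ((1/2) powr a) powr real (Suc k)"
      by (simp only: powr_powr mult.commute)
    also have "\<dots> = ((1/2) powr a) ^ Suc k"
      by (subst powr_realpow) auto
    finally have "q k = (1/2) powr a * ((1/2) powr a) ^ k" by simp
    moreover have "r ^ k = (1/2) ^ k * ((1/2) powr a) ^ k"
      by (simp add: r_def powr_add power_mult_distrib[symmetric])
    ultimately show ?thesis by simp
  qed
  have "(\<integral>\<^sup>+w. indicator B_ball w * ennreal (minor (insert j J) w powr a) \<partial>lborel)
      \<le> (\<integral>\<^sup>+w. (\<Sum>k. ennreal (q k) * (indicator (E k) w * G w)) \<partial>lborel)"
    by (intro nn_integral_mono pointwise)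
  also have "\<dots> = (\<Sum>k. ennreal (q k) * (\<integral>\<^sup>+w. indicator (E k) w * G w \<partial>lborel))"
    by (subst nn_integral_suminf) (simp_all add: nn_integral_cmult)
  also have "\<dots> \<le> (\<Sum>k. ennreal (q k * ((real m + 1) * (1/2) ^ k)) * I)"
  proof (intro suminf_le allI)
    fix k
    have "ennreal (q k) * (\<integral>\<^sup>+w. indicator (E k) w * G w \<partial>lborel)
        \<le> ennreal (q k) * (ennreal ((real m + 1) * (1/2) ^ k) * I)"
      by (intro mult_left_mono shell) simp
    then show "ennreal (q k) * (\<integral>\<^sup>+w. indicator (E k) w * G w \<partial>lborel)
        \<le> ennreal (q k * ((real m + 1) * (1/2) ^ k)) * I"
      by (simp add: ennreal_mult q_def mult.assoc)
  qed simp_all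
  also have "\<dots> = (\<Sum>k. ennreal ((1/2) powr a * (real m + 1) * r ^ k)) * I"
    unfolding qr by simp
  also have "(\<Sum>k. ennreal ((1/2) powr a * (real m + 1) * r ^ k)) = ennreal (\<Sum>k. (1/2) powr a * (real m + 1) * r ^ k)"
    using r by (intro suminf_ennreal2) (auto intro!: summable_mult summable_geometric)
  also have "\<dots> * I < \<infinity>" using finI by (simp add: ennreal_mult_less_top)
  finally show ?thesis .
qed

text \<open>
  For \<open>a \<ge> 0\<close> the integrand is bounded by one.  For negative \<open>a\<close> the index set of the minor grows
  from the empty set, where the integral is the volume of the ball, to the full one.
\<close>

lemma defect_powr_integral_finite:
  assumes "-1 < a"
  shows "(\<integral>\<^sup>+w. indicator B_ball w * ennreal (Re (defect (w :: ('q::{finite,linorder}) cmat)) powr a) \<partial>lborel) < \<infinity>"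
proof -
  have ball: "(\<integral>\<^sup>+w. indicator B_ball (w :: 'q cmat) \<partial>lborel) < \<infinity>"
    using emeasure_bounded_finite[OF bounded_B_ball] by simp
  show ?thesis
  proof (cases "a < 0")
    case True
    have "(\<integral>\<^sup>+w. indicator B_ball w * ennreal (minor J (w :: 'q cmat) powr a) \<partial>lborel) < \<infinity>"
      for J
    proof (induction J rule: finite_induct[OF finite])
      case 1
      then show ?case using ball by (simp add: minor_empty)
    next
      case (2 j J)
      then show ?case using assms True by (intro minor_powr_integral_step)
    qed
    from this[of UNIV] show ?thesis by (simp add: minor_UNIV)
  next
    case False
    have "indicator B_ball w * ennreal (Re (defect w) powr a) \<le> indicator B_ball w"
      for w :: "'q cmat"
    proof (cases "w \<in> B_ball")
      case True
      then have "Re (defect w) powr a \<le> 1 powr a"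
        using False defect_pos_le_1[OF True] by (intro powr_mono2) auto
      then show ?thesis using True by (simp add: ennreal_le_1)
    qed simp
    then have "(\<integral>\<^sup>+w. indicator B_ball w * ennreal (Re (defect (w :: 'q cmat)) powr a) \<partial>lborel)
        \<le> (\<integral>\<^sup>+w. indicator B_ball (w :: 'q cmat) \<partial>lborel)"
      by (intro nn_integral_mono)
    then show ?thesis using ball by (rule le_less_trans)
  qed
qed

lemma weight_eq: "weight p (w :: complex^'q^'q) = Re (defect w) powr (p - 2 * real CARD('q))"
  by (simp add: weight_def defect_def)

lemma borel_measurable_weight [measurable]: "weight p \<in> borel_measurable borel"
proof -
  have "(\<lambda>w :: complex^'q^'q. Re (defect w)) \<in> borel_measurable borel"
    by (intro borel_measurable_continuous_onI continuous_intros)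
  then show ?thesis unfolding weight_eq[abs_def] by measurable
qed

lemma weight_pos:
  fixes w :: "('q::{finite,linorder}) cmat"
  shows "w \<in> B_ball \<Longrightarrow> 0 < weight p w"
  using defect_pos_le_1(1)[of w] by (simp add: weight_eq)

lemma open_emeasure_lborel_pos:
  fixes U :: "'a::euclidean_space set"
  assumes "open U" "U \<noteq> {}"
  shows "emeasure lborel U > 0"
proof (rule ccontr)
  assume "\<not> emeasure lborel U > 0"
  then have "U \<in> null_sets lborel" using assms(1) by (auto intro!: null_setsI)
  then have "negligible U" by (simp add: negligible_iff_null_sets null_sets_completionI)
  then show False using open_not_negligible[OF assms] by simp
qed

text \<open>
  The normalising constant would be zero if the weight were not integrable, and all convolutions
  would then have empty support; the classification rests on this positivity.
\<close>

lemma kappa_pos: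
  assumes "p > 2 * real CARD('q::{finite,linorder}) - 1"
  shows "0 < kappa TYPE('q) p"
proof -
  define f where "f w = indicator B_ball w *\<^sub>R weight p w" for w :: "'q cmat"
  have nonneg: "0 \<le> f w" for w by (simp add: f_def weight_eq)
  have f[measurable]: "f \<in> borel_measurable borel" unfolding f_def by measurable
  have "(\<integral>\<^sup>+w. ennreal (f w) \<partial>lborel)
      = (\<integral>\<^sup>+w. indicator B_ball w * ennreal (Re (defect (w :: 'q cmat)) powr (p - 2 * real CARD('q))) \<partial>lborel)"
    by (intro nn_integral_cong) (auto simp: f_def weight_eq indicator_def)
  also have "\<dots> < \<infinity>" using assms by (intro defect_powr_integral_finite) simp
  finally have int: "integrable lborel f"
    by (intro integrableI_nonneg) (auto simp: nonneg)
  have "integral\<^sup>L lborel f \<noteq> 0"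
  proof
    assume "integral\<^sup>L lborel f = 0"
    then have "AE w in lborel. f w = 0"
      using int nonneg by (simp add: integral_nonneg_eq_0_iff_AE)
    then have "AE w in lborel. w \<notin> (B_ball :: 'q cmat set)"
      by eventually_elim (metis f_def weight_pos indicator_simps(1) less_irrefl scaleR_one)
    then have "emeasure lborel (B_ball :: 'q cmat set) = 0"
      by (subst (asm) AE_iff_measurable[OF _ refl]) auto
    moreover have "(0 :: 'q cmat) \<in> B_ball" by (rule zero_in_B_ball)
    then have "emeasure lborel (B_ball :: 'q cmat set) > 0"
      by (intro open_emeasure_lborel_pos open_B_ball) auto
    ultimately show False by simp
  qed
  moreover have "0 \<le> integral\<^sup>L lborel f" using nonneg by simp
  ultimately show ?thesis
    by (simp add: kappa_def set_lebesgue_integral_def f_def[abs_def])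
qed

section \<open>The support of a convolution\<close>

lemma conv_map_eq:
  "conv_map (r, a) (s, b) w =
    (msqrt (r ** r + s ** s + r ** w ** s + ctransp (r ** w ** s)), a + b - Im (trace (r ** w ** s)))"
  by (simp add: conv_map_def Let_def)

text \<open>The closed unit ball of the operator norm, the closure of \<^const>\<open>B_ball\<close>.\<close>

abbreviation contractions :: "(complex^'q^'q) set" where
  "contractions \<equiv> {w. \<forall>v. norm (w *v v) \<le> norm v}"

lemma B_ball_contraction: "w \<in> B_ball \<Longrightarrow> w \<in> contractions"
  by (auto simp: B_ball_iff) (metis less_imp_le matrix_vector_mult_0_right norm_zero order_refl)

text \<open>
  The form of the radicand at \<open>v\<close> is at least \<open>(\<parallel>r v\<parallel> - \<parallel>s v\<parallel>)\<^sup>2\<close>, as the cross terms are bounded by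
  the inequality of Cauchy and Schwarz.
\<close>

lemma conv_radicand_in_Pi_cone:
  fixes r s w :: "complex^'q^'q"
  assumes r: "r \<in> Pi_cone" and s: "s \<in> Pi_cone" and w: "w \<in> contractions"
  shows "r ** r + s ** s + r ** w ** s + ctransp (r ** w ** s) \<in> Pi_cone"
  unfolding Pi_cone_iff
proof (intro conjI allI)
  show "ctransp (r ** r + s ** s + r ** w ** s + ctransp (r ** w ** s))
      = r ** r + s ** s + r ** w ** s + ctransp (r ** w ** s)"
    using r s by (simp add: ctransp_add ctransp_mult Pi_cone_hermitian algebra_simps)
  fix v :: "complex^'q"
  have cross: "v \<bullet> ((r ** w ** s) *v v) = (r *v v) \<bullet> (w *v (s *v v))"
    using inner_matrix_vector_mult[of v r "w *v (s *v v)"] r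
    by (simp add: Pi_cone_hermitian matrix_vector_mul_assoc matrix_mul_assoc)
  have cross': "v \<bullet> (ctransp (r ** w ** s) *v v) = v \<bullet> ((r ** w ** s) *v v)"
    by (simp only: inner_matrix_vector_mult[of v "ctransp _"] ctransp_ctransp inner_commute)
  have "\<bar>(r *v v) \<bullet> (w *v (s *v v))\<bar> \<le> norm (r *v v) * norm (w *v (s *v v))"
    by (rule Cauchy_Schwarz_ineq2)
  also have "\<dots> \<le> norm (r *v v) * norm (s *v v)"
    using w by (intro mult_left_mono) auto
  finally have "- (norm (r *v v) * norm (s *v v)) \<le> (r *v v) \<bullet> (w *v (s *v v))" by linarith
  moreover have "0 \<le> (norm (r *v v) - norm (s *v v))\<^sup>2" by simp
  ultimately show "0 \<le> v \<bullet> ((r ** r + s ** s + r ** w ** s + ctransp (r ** w ** s)) *v v)"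
    using r s
    by (simp only: matrix_vector_mult_add_rdistrib inner_add_right inner_psd_square cross cross' power2_diff)
qed

lemma continuous_on_conv_map:
  fixes r s :: "('q::{finite,linorder}) cmat"
  assumes "r \<in> Pi_cone" "s \<in> Pi_cone"
  shows "continuous_on contractions (conv_map (r, a) (s, b))"
  unfolding conv_map_eq[abs_def]
proof (intro continuous_on_Pair)
  have "continuous_on contractions (\<lambda>w. r ** r + s ** s + r ** w ** s + ctransp (r ** w ** s))"
    by (intro continuous_intros)
  then show "continuous_on contractions (\<lambda>w. msqrt (r ** r + s ** s + r ** w ** s + ctransp (r ** w ** s)))"
    by (rule continuous_on_compose2[OF continuous_on_msqrt])
      (intro image_subsetI conv_radicand_in_Pi_cone assms)
  show "continuous_on contractions (\<lambda>w. a + b - Im (trace (r ** w ** s)))"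
    by (intro continuous_intros)
qed

lemma borel_measurable_conv_map:
  fixes r s :: "('q::{finite,linorder}) cmat"
  shows "conv_map (r, a) (s, b) \<in> borel_measurable borel"
  unfolding conv_map_eq[abs_def]
proof (intro borel_measurable_Pair)
  have "(\<lambda>w. r ** r + s ** s + r ** w ** s + ctransp (r ** w ** s)) \<in> borel_measurable borel"
    by (intro borel_measurable_continuous_onI continuous_intros)
  then show "(\<lambda>w. msqrt (r ** r + s ** s + r ** w ** s + ctransp (r ** w ** s))) \<in> borel_measurable borel"
    by (rule measurable_compose[OF _ borel_measurable_msqrt])
  show "(\<lambda>w. a + b - Im (trace (r ** w ** s))) \<in> borel_measurable borel"
    by (intro borel_measurable_continuous_onI continuous_intros)
qed

text \<open>
  The transport map is continuous on the open ball, where the weight is positive, so the preimage of a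
  neighbourhood of an attained value has positive mass.
\<close>

lemma conv_map_in_msupport:
  fixes r s :: "('q::{finite,linorder}) cmat"
  assumes p: "p > 2 * real CARD('q) - 1" and rs: "r \<in> Pi_cone" "s \<in> Pi_cone" and w: "w \<in> B_ball"
  shows "conv_map (r, a) (s, b) w \<in> msupport (conv p (r, a) (s, b))"
  unfolding msupport_def mem_Collect_eq
proof (intro allI impI, elim conjE)
  fix U assume U: "open U" and mem: "conv_map (r, a) (s, b) w \<in> U"
  define T where "T = conv_map (r, a) (s, b)"
  define g where "g w = ennreal (kappa TYPE('q) p * (indicator B_ball w * weight p w))" for w :: "'q cmat"
  have T[measurable]: "T \<in> borel_measurable borel"
    unfolding T_def by (rule borel_measurable_conv_map)
  have g[measurable]: "g \<in> borel_measurable borel" unfolding g_def by measurable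
  have [measurable]: "U \<in> sets borel" using U by simp
  have "emeasure (conv p (r, a) (s, b)) U = emeasure (density lborel g) (T -` U)"
    unfolding conv_def T_def[symmetric] g_def[symmetric] by (subst emeasure_distr) simp_all
  also have "\<dots> = (\<integral>\<^sup>+x. g x * indicator (T -` U) x \<partial>lborel)"
    by (intro emeasure_density) (use measurable_sets[OF T, of U] in simp_all)
  also have "\<dots> > 0"
  proof (rule ccontr)
    assume "\<not> (\<integral>\<^sup>+x. g x * indicator (T -` U) x \<partial>lborel) > 0"
    then have "(\<integral>\<^sup>+x. g x * indicator (T -` U) x \<partial>lborel) = 0" by simp
    moreover have "(\<lambda>x. g x * indicator (T -` U) x) \<in> borel_measurable lborel"
      using measurable_sets[OF T, of U] by simp
    ultimately have "AE x in lborel. g x * indicator (T -` U) x = 0"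
      by (simp add: nn_integral_0_iff_AE)
    then have "AE x in lborel. x \<notin> B_ball \<inter> T -` U"
    proof eventually_elim
      case (elim x)
      have "g x > 0" if "x \<in> B_ball"
        using that kappa_pos[OF p] weight_pos[OF that] by (simp add: g_def)
      with elim show ?case by (auto simp: indicator_def)
    qed
    moreover have "continuous_on B_ball T"
      unfolding T_def using B_ball_contraction
      by (intro continuous_on_subset[OF continuous_on_conv_map[OF rs]] subsetI)
    then have op: "open (B_ball \<inter> T -` U)"
      by (intro continuous_open_preimage open_B_ball U)
    ultimately have "emeasure lborel (B_ball \<inter> T -` U) = 0"
      by (subst (asm) AE_iff_null_sets[symmetric]) (auto intro: borel_open)
    moreover have "w \<in> B_ball \<inter> T -` U" using w mem by (simp add: T_def)
    ultimately show False using open_emeasure_lborel_pos[OF op] by auto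
  qed
  finally show "0 < emeasure (conv p (r, a) (s, b)) U" .
qed

section \<open>Closure properties of subhypergroups\<close>

context
  fixes p :: real and X :: "(('q::{finite,linorder}) cmat \<times> real) set"
  assumes p: "p > 2 * real CARD('q) - 1" and sub: "subhypergroup p X"
begin

lemma closed_subhypergroup: "closed X"
  and subhypergroup_in_Pi_cone: "(r, a) \<in> X \<Longrightarrow> r \<in> Pi_cone"
proof -
  have cl: "closedin (top_of_set (Pi_cone \<times> UNIV)) X" using sub by (simp add: subhypergroup_def)
  then show "closed X" by (rule closedin_closed_trans) (intro closed_Times closed_Pi_cone closed_UNIV)
  show "(r, a) \<in> X \<Longrightarrow> r \<in> Pi_cone" using closedin_imp_subset[OF cl] by auto
qed

lemma subhypergroup_inverse: "(r, a) \<in> X \<Longrightarrow> (r, - a) \<in> X"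
  using sub by (force simp: subhypergroup_def hinv_def)

text \<open>
  For \<open>w\<close> on the boundary of the ball, approximate by \<open>c w\<close> with \<open>c < 1\<close> and use that \<open>X\<close> is closed.
\<close>

lemma conv_map_in_subhypergroup:
  assumes X: "(r, a) \<in> X" "(s, b) \<in> X" and w: "w \<in> contractions"
  shows "conv_map (r, a) (s, b) w \<in> X"
proof (rule closed_sequentially[OF closed_subhypergroup])
  have rs: "r \<in> Pi_cone" "s \<in> Pi_cone" using X by (auto intro: subhypergroup_in_Pi_cone)
  define c where "c n = 1 - 1 / real (Suc n)" for n
  have c: "0 \<le> c n" "c n < 1" for n by (simp_all add: c_def)
  have ball: "c n *\<^sub>R w \<in> B_ball" for n
    unfolding B_ball_iff
  proof (intro allI impI)
    fix v :: "'q cvec" assume "v \<noteq> 0"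
    have "c n * norm (w *v v) \<le> c n * norm v" using w c by (intro mult_left_mono) auto
    also have "\<dots> < 1 * norm v" using c \<open>v \<noteq> 0\<close> by (intro mult_strict_right_mono) auto
    finally show "norm ((c n *\<^sub>R w) *v v) < norm v" using c by (simp add: scaleR_matrix_vector_mult)
  qed
  show "conv_map (r, a) (s, b) (c n *\<^sub>R w) \<in> X" for n
    using conv_map_in_msupport[OF p rs ball] sub X unfolding subhypergroup_def by blast
  have "c \<longlonglongrightarrow> 1 - 0" unfolding c_def
    by (intro tendsto_diff tendsto_const LIMSEQ_Suc lim_1_over_n)
  then have "(\<lambda>n. c n *\<^sub>R w) \<longlonglongrightarrow> 1 *\<^sub>R w" by (intro tendsto_intros) simp
  then have lim: "(\<lambda>n. c n *\<^sub>R w) \<longlonglongrightarrow> w" by simp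
  show "(\<lambda>n. conv_map (r, a) (s, b) (c n *\<^sub>R w)) \<longlonglongrightarrow> conv_map (r, a) (s, b) w"
    by (rule continuous_on_tendsto_compose[OF continuous_on_conv_map[OF rs] lim w])
      (intro always_eventually allI B_ball_contraction ball)
qed

lemma subhypergroup_msqrt_sum:
  assumes "(r, a) \<in> X" "(s, b) \<in> X"
  shows "(msqrt (r ** r + s ** s), a + b) \<in> X"
  using conv_map_in_subhypergroup[OF assms, of 0] by (simp add: conv_map_eq trace_def)

text \<open>The convolution of \<open>(r, a)\<close> with \<open>(0, b)\<close> is a point mass, since all terms with \<open>w\<close> vanish.\<close>

lemma subhypergroup_shift:
  assumes "(r, a) \<in> X" "(0, b) \<in> X"
  shows "(r, a + b) \<in> X"
  using subhypergroup_msqrt_sum[OF assms] msqrt_eqI[OF subhypergroup_in_Pi_cone[OF assms(1)] refl] by simp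

lemma mat_contraction: "norm z \<le> 1 \<Longrightarrow> mat z \<in> (contractions :: 'q cmat set)"
proof (intro CollectI allI)
  fix v :: "'q cvec" assume z: "norm z \<le> 1"
  have "(mat z *v v) $ i = z * v $ i" for i
    by (simp add: matrix_vector_mult_def mat_def mult_delta_left)
  then show "norm (mat z *v v) \<le> norm v"
    unfolding norm_vec_def using z by (intro L2_set_mono) (simp_all add: norm_mult mult_left_le_one_le)
qed

text \<open>
  For \<open>w = z I\<close> the radicand is \<open>(2 + 2 Re z) r\<^sup>2\<close>: real \<open>z\<close> rescales the cone part, and the
  imaginary part of \<open>z\<close> moves the real coordinate.
\<close>

lemma conv_map_scalar:
  assumes r: "(r, a) \<in> X" and t: "0 \<le> t" "t\<^sup>2 = 2 + 2 * Re z"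
  shows "conv_map (r, a) (r, b) (mat z) = (t *\<^sub>R r, a + b - Im z * (norm r)\<^sup>2)"
proof -
  have rP: "r \<in> Pi_cone" using r by (rule subhypergroup_in_Pi_cone)
  have P: "ctransp (r ** r) = r ** r" using rP by (simp add: ctransp_mult Pi_cone_hermitian)
  have rzr: "r ** mat z ** r = (\<chi> i j. z * (r ** r) $ i $ j)"
    by (simp add: matrix_mul_assoc[symmetric] mat_matrix_mult)
      (simp add: vec_eq_iff matrix_matrix_mult_def sum_distrib_left mult_ac)
  have "r ** r + r ** r + r ** mat z ** r + ctransp (r ** mat z ** r) = (t *\<^sub>R r) ** (t *\<^sub>R r)"
  proof -
    have "cnj ((r ** r) $ j $ i) = (r ** r) $ i $ j" for i j
      using P by (metis ctransp_nth)
    then have "(r ** r + r ** r + r ** mat z ** r + ctransp (r ** mat z ** r)) $ i $ j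
        = (2 + z + cnj z) * (r ** r) $ i $ j" for i j
      by (simp add: rzr algebra_simps)
    moreover have "2 + z + cnj z = of_real (t\<^sup>2)" by (simp only: t(2)) (simp add: complex_eq_iff)
    ultimately show ?thesis
      by (simp add: vec_eq_iff power2_eq_square scaleR_conv_of_real[where 'a=complex])
  qed
  then have "msqrt (r ** r + r ** r + r ** mat z ** r + ctransp (r ** mat z ** r)) = t *\<^sub>R r"
    by (intro msqrt_eqI Pi_cone_scaleR t rP) simp
  moreover have "trace (r ** mat z ** r) = z * trace (r ** r)"
    by (simp add: rzr trace_def sum_distrib_left)
  then have "Im (trace (r ** mat z ** r)) = Im z * (norm r)\<^sup>2"
    using trace_gram[of r] rP by (simp add: Pi_cone_hermitian)
  ultimately show ?thesis by (simp add: conv_map_eq)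
qed

lemma subhypergroup_scale_le_2:
  assumes "(r, a) \<in> X" "0 \<le> t" "t \<le> 2"
  shows "(t *\<^sub>R r, 0) \<in> X"
proof -
  define z where "z = complex_of_real (t\<^sup>2 / 2 - 1)"
  have "t\<^sup>2 \<le> 2\<^sup>2" using assms by (intro power_mono) auto
  then have "\<bar>t\<^sup>2 / 2 - 1\<bar> \<le> 1" by (auto simp: abs_le_iff)
  then have z: "norm z \<le> 1" unfolding z_def norm_of_real .
  have "conv_map (r, a) (r, - a) (mat z) = (t *\<^sub>R r, a + (- a) - Im z * (norm r)\<^sup>2)"
    by (rule conv_map_scalar[OF assms(1,2)]) (simp add: z_def)
  moreover have "conv_map (r, a) (r, - a) (mat z) \<in> X"
    by (intro conv_map_in_subhypergroup assms(1) subhypergroup_inverse mat_contraction z)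
  ultimately show ?thesis by (simp add: z_def)
qed

text \<open>A single convolution reaches factors up to \<open>2\<close>; iterating it reaches all of them.\<close>

lemma subhypergroup_scale:
  assumes "(r, a) \<in> X" "0 \<le> t"
  shows "(t *\<^sub>R r, 0) \<in> X"
proof -
  have "t \<le> 2 ^ n \<Longrightarrow> 0 \<le> t \<Longrightarrow> (t *\<^sub>R r, 0) \<in> X" for t and n :: nat
  proof (induction n arbitrary: t)
    case 0
    then show ?case using subhypergroup_scale_le_2[OF assms(1)] by simp
  next
    case (Suc n)
    have "((t / 2) *\<^sub>R r, 0) \<in> X" using Suc.prems by (intro Suc.IH) simp_all
    from subhypergroup_scale_le_2[OF this, of 2] show ?case by simp
  qed
  moreover obtain n where "t < 2 ^ n" using real_arch_pow[of 2 t] by auto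
  ultimately show ?thesis using assms(2) by (meson less_imp_le)
qed

text \<open>
  With \<open>w = z I\<close>, \<open>z\<close> on the unit circle near \<open>-1\<close>, the point \<open>(n r, 0)\<close> convolved with itself
  reaches points whose cone part is \<open>O(1/n)\<close> while the real part is any prescribed \<open>b\<close>.
\<close>

lemma subhypergroup_contains_vertical_line:
  assumes r: "(r, a) \<in> X" "r \<noteq> 0"
  shows "(0, b) \<in> X"
proof -
  define \<tau> where "\<tau> = (norm r)\<^sup>2"
  have \<tau>: "\<tau> > 0" using r by (simp add: \<tau>_def)
  define d where "d n = - b / ((real n)\<^sup>2 * \<tau>)" for n
  define c where "c n = sqrt (1 - (d n)\<^sup>2)" for n
  define f where "f n = (sqrt (2 - 2 * c n) *\<^sub>R (real n *\<^sub>R r), b)" for n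
  obtain N :: nat where N: "\<bar>b\<bar> / \<tau> + 1 \<le> real N" using real_arch_simple by blast
  have large: "real n > 0 \<and> \<bar>d n\<bar> \<le> 1" if "n \<ge> N" for n
  proof -
    have bn: "\<bar>b\<bar> / \<tau> + 1 \<le> real n" using N that by linarith
    have n1: "1 \<le> real n" using bn \<tau> by (smt (verit) divide_nonneg_pos abs_ge_zero)
    have "real n * 1 \<le> real n * real n" using n1 by (intro mult_left_mono) auto
    then have "\<bar>b\<bar> / \<tau> \<le> (real n)\<^sup>2" using bn by (simp add: power2_eq_square)
    then have "\<bar>b\<bar> \<le> (real n)\<^sup>2 * \<tau>" using \<tau> by (simp add: pos_divide_le_eq)
    then show ?thesis using \<tau> n1 by (simp add: d_def abs_mult)
  qed
  have cd: "(c n)\<^sup>2 + (d n)\<^sup>2 = 1" "0 \<le> c n" "c n \<le> 1" if "n \<ge> N" for n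
    using large[OF that] by (auto simp: c_def abs_square_le_1)
  have inX: "f n \<in> X" if n: "n \<ge> N" for n
  proof -
    define z where "z = Complex (- c n) (d n)"
    have nr: "(real n *\<^sub>R r, 0) \<in> X" by (rule subhypergroup_scale[OF r(1)]) simp
    have "norm z \<le> 1" using cd[OF n] by (simp add: z_def cmod_def)
    then have "conv_map (real n *\<^sub>R r, 0) (real n *\<^sub>R r, 0) (mat z) \<in> X"
      by (intro conv_map_in_subhypergroup nr mat_contraction)
    moreover have "conv_map (real n *\<^sub>R r, 0) (real n *\<^sub>R r, 0) (mat z)
        = (sqrt (2 - 2 * c n) *\<^sub>R (real n *\<^sub>R r), 0 + 0 - Im z * (norm (real n *\<^sub>R r))\<^sup>2)"
      by (rule conv_map_scalar[OF nr]) (use cd[OF n] in \<open>simp_all add: z_def\<close>)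
    moreover have "- d n * ((real n)\<^sup>2 * \<tau>) = b"
      using large[OF n] \<tau> by (simp add: d_def)
    ultimately show ?thesis by (simp add: f_def z_def \<tau>_def power_mult_distrib)
  qed
  have bound: "norm (sqrt (2 - 2 * c n) *\<^sub>R (real n *\<^sub>R r)) \<le> sqrt 2 * \<bar>b\<bar> / \<tau> * norm r * (1 / real n)" if n: "n \<ge> N" for n
  proof -
    have "1 - c n \<le> (d n)\<^sup>2"
      using cd[OF n] mult_right_mono[of "c n" 1 "c n"] by (simp add: power2_eq_square)
    then have "sqrt (2 - 2 * c n) \<le> sqrt (2 * (d n)\<^sup>2)" by simp
    also have "\<dots> = sqrt 2 * \<bar>d n\<bar>" by (simp add: real_sqrt_mult)
    finally have "sqrt (2 - 2 * c n) * (real n * norm r) \<le> sqrt 2 * \<bar>d n\<bar> * (real n * norm r)"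
      by (intro mult_right_mono) auto
    also have "\<dots> = sqrt 2 * \<bar>b\<bar> / \<tau> * norm r * (1 / real n)"
      using large[OF n] \<tau> by (simp add: d_def abs_mult power2_eq_square field_simps)
    finally show ?thesis using cd[OF n] by simp
  qed
  have "(\<lambda>n. sqrt 2 * \<bar>b\<bar> / \<tau> * norm r * (1 / real n)) \<longlonglongrightarrow> sqrt 2 * \<bar>b\<bar> / \<tau> * norm r * 0"
    by (intro tendsto_mult tendsto_const lim_1_over_n)
  then have lim0: "(\<lambda>n. sqrt 2 * \<bar>b\<bar> / \<tau> * norm r * (1 / real n)) \<longlonglongrightarrow> 0" by simp
  have "(\<lambda>n. sqrt (2 - 2 * c n) *\<^sub>R (real n *\<^sub>R r)) \<longlonglongrightarrow> 0"
    by (rule Lim_null_comparison[OF _ lim0]) (use bound in \<open>auto simp: eventually_sequentially\<close>)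
  then have "f \<longlonglongrightarrow> (0, b)"
    unfolding f_def by (intro tendsto_Pair tendsto_const)
  then show ?thesis
    by (rule Lim_in_closed_set[OF closed_subhypergroup, rotated 2])
      (use inX in \<open>auto simp: eventually_sequentially\<close>)
qed

text \<open>
  For \<open>Z = Y Y\<^sup>*\<close> and large \<open>t\<close> the matrix \<open>w = Z / (2 t\<^sup>2) - I\<close> is a Hermitian contraction, and
  convolving \<open>(t r, 0)\<close> with itself at \<open>w\<close> gives the square root of \<open>r Z r = (r Y) (r Y)\<^sup>*\<close>.
\<close>

lemma subhypergroup_factor:
  assumes r: "(r, a) \<in> X" "r \<noteq> 0" and s: "s \<in> Pi_cone" and sY: "s = r ** Y"
  shows "(s, b) \<in> X"
proof -
  have rP: "r \<in> Pi_cone" using r(1) by (rule subhypergroup_in_Pi_cone)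
  define Z where "Z = Y ** ctransp Y"
  define t where "t = norm Y / 2 + 1"
  have t: "t > 0" "(norm Y)\<^sup>2 \<le> 4 * t\<^sup>2"
  proof -
    show "t > 0" by (simp add: t_def add_nonneg_pos)
    have "(norm Y)\<^sup>2 \<le> (2 * t)\<^sup>2" by (intro power_mono) (simp_all add: t_def)
    then show "(norm Y)\<^sup>2 \<le> 4 * t\<^sup>2" by (simp add: power_mult_distrib)
  qed
  define e where "e = 1 / (2 * t\<^sup>2)"
  have e: "e > 0" "e * (norm Y)\<^sup>2 \<le> 2" "2 * t\<^sup>2 * e = 1" 
    using t by (simp_all add: e_def divide_le_eq)
  define w where "w = e *\<^sub>R Z - mat 1"
  have "w \<in> contractions"
  proof (intro CollectI allI)
    fix v :: "'q cvec"
    have q: "v \<bullet> (Z *v v) = (norm (ctransp Y *v v))\<^sup>2"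
      using inner_gram[of v "ctransp Y"] by (simp add: Z_def)
    have "norm (Z *v v) \<le> norm Y * norm (ctransp Y *v v)"
      using norm_matrix_vector_mult_le[of Y "ctransp Y *v v"] by (simp add: Z_def matrix_vector_mul_assoc)
    then have "(norm (Z *v v))\<^sup>2 \<le> (norm Y * norm (ctransp Y *v v))\<^sup>2" by (intro power_mono) auto
    then have n: "(norm (Z *v v))\<^sup>2 \<le> (norm Y)\<^sup>2 * (v \<bullet> (Z *v v))" by (simp add: power_mult_distrib q)
    have wv: "w *v v = e *\<^sub>R (Z *v v) - v"
      by (simp add: w_def matrix_vector_mult_diff_rdistrib scaleR_matrix_vector_mult)
    have "(norm (w *v v))\<^sup>2 = e\<^sup>2 * (norm (Z *v v))\<^sup>2 - 2 * e * (v \<bullet> (Z *v v)) + (norm v)\<^sup>2"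
      unfolding wv power2_norm_eq_inner inner_diff_left inner_diff_right inner_scaleR_left
        inner_scaleR_right inner_commute[of "Z *v v" v] by (simp add: power2_eq_square algebra_simps)
    also have "\<dots> \<le> e * (e * (norm Y)\<^sup>2) * (v \<bullet> (Z *v v)) - 2 * e * (v \<bullet> (Z *v v)) + (norm v)\<^sup>2"
      using mult_left_mono[OF n, of "e\<^sup>2"] by (simp add: power2_eq_square algebra_simps)
    also have "e * (e * (norm Y)\<^sup>2) * (v \<bullet> (Z *v v)) \<le> e * 2 * (v \<bullet> (Z *v v))"
      using e by (intro mult_right_mono mult_left_mono) (simp_all add: q)
    finally have "(norm (w *v v))\<^sup>2 \<le> (norm v)\<^sup>2" by simp
    then show "norm (w *v v) \<le> norm v" by (rule power2_le_imp_le) simp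
  qed
  have "(t *\<^sub>R r, 0) \<in> X" using r(1) t by (intro subhypergroup_scale) auto
  from conv_map_in_subhypergroup[OF this this \<open>w \<in> contractions\<close>]
  obtain b' where inX: "(msqrt ((t *\<^sub>R r) ** (t *\<^sub>R r) + (t *\<^sub>R r) ** (t *\<^sub>R r) + (t *\<^sub>R r) ** w ** (t *\<^sub>R r)
      + ctransp ((t *\<^sub>R r) ** w ** (t *\<^sub>R r))), b') \<in> X"
    by (simp add: conv_map_eq)
  have rZr: "r ** Z ** r = s ** s"
  proof -
    have "r ** Z ** r = s ** ctransp s"
      using rP by (simp add: Z_def sY ctransp_mult Pi_cone_hermitian matrix_mul_assoc)
    then show ?thesis using s by (simp add: Pi_cone_hermitian)
  qed
  have rwr: "(t *\<^sub>R r) ** w ** (t *\<^sub>R r) = (t\<^sup>2 * e) *\<^sub>R (s ** s) - t\<^sup>2 *\<^sub>R (r ** r)"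
    by (simp add: w_def matrix_mult_diff_left matrix_mult_diff_right rZr power2_eq_square algebra_simps)
  have ct: "ctransp ((t *\<^sub>R r) ** w ** (t *\<^sub>R r)) = (t\<^sup>2 * e) *\<^sub>R (s ** s) - t\<^sup>2 *\<^sub>R (r ** r)"
    unfolding rwr using rP s by (simp add: ctransp_diff ctransp_scaleR ctransp_mult Pi_cone_hermitian)
  have "(t *\<^sub>R r) ** (t *\<^sub>R r) + (t *\<^sub>R r) ** (t *\<^sub>R r) + (t *\<^sub>R r) ** w ** (t *\<^sub>R r)
      + ctransp ((t *\<^sub>R r) ** w ** (t *\<^sub>R r)) = (2 * t\<^sup>2 * e) *\<^sub>R (s ** s)"
    unfolding ct unfolding rwr
    by (simp add: vec_eq_iff scaleR_conv_of_real[where 'a=complex] power2_eq_square algebra_simps)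
  then have "(s, b') \<in> X"
    using inX msqrt_eqI[OF s refl] by (simp add: e)
  from subhypergroup_shift[OF this subhypergroup_contains_vertical_line[OF r, of "b - b'"]]
  show ?thesis by simp
qed

text \<open>
  Minimise the dimension of the kernel over \<open>X\<close>.  Since \<open>X\<close> contains \<open>\<surd>(r\<^sup>2 + s\<^sup>2)\<close>, whose kernel is
  the intersection of those of \<open>r\<close> and \<open>s\<close>, the minimal kernel lies in every other one.
\<close>

lemma subhypergroup_minimal_kernel:
  assumes "X \<noteq> {}"
  obtains r a where "(r, a) \<in> X" "\<And>s b v. (s, b) \<in> X \<Longrightarrow> r *v v = 0 \<Longrightarrow> s *v v = 0"
proof -
  define K where "K x = {v. fst x *v v = 0}" for x :: "'q cmat \<times> real"
  have sub: "subspace (K x)" for x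
    by (auto simp: subspace_def K_def matrix_vector_right_distrib matrix_vector_mult_scaleR)
  obtain x where x: "x \<in> X" and min: "\<And>y. y \<in> X \<Longrightarrow> dim (K x) \<le> dim (K y)"
    using ex_has_least_nat[of "\<lambda>x. x \<in> X" _ "\<lambda>x. dim (K x)"] assms by blast
  obtain r a where ra: "x = (r, a)" by (cases x)
  show thesis
  proof (rule that)
    show "(r, a) \<in> X" using x ra by simp
    fix s b v assume s: "(s, b) \<in> X" and v: "r *v v = 0"
    have P: "r \<in> Pi_cone" "s \<in> Pi_cone" using x ra s by (auto intro: subhypergroup_in_Pi_cone)
    define y where "y = (msqrt (r ** r + s ** s), a + b)"
    have y: "y \<in> X" using x ra s by (auto simp: y_def intro: subhypergroup_msqrt_sum)
    have cone: "r ** r + s ** s \<in> Pi_cone" using P by (intro Pi_cone_add Pi_cone_square)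
    have ker: "r *v u = 0 \<and> s *v u = 0" if "u \<in> K y" for u
    proof -
      let ?m = "msqrt (r ** r + s ** s)"
      have "(norm (?m *v u))\<^sup>2 = u \<bullet> ((r ** r + s ** s) *v u)"
        using inner_psd_square[OF msqrt_in_Pi_cone[OF cone], of u] by (simp add: msqrt_square[OF cone])
      also have "\<dots> = (norm (r *v u))\<^sup>2 + (norm (s *v u))\<^sup>2"
        by (simp add: matrix_vector_mult_add_rdistrib inner_add_right inner_psd_square P)
      finally show ?thesis using that by (simp add: K_def y_def sum_power2_eq_zero_iff)
    qed
    then have "K y \<subseteq> K x" by (auto simp: K_def ra)
    then have "K y = K x" using min[OF y] by (intro subspace_dim_equal sub)
    moreover have "v \<in> K x" using v by (simp add: K_def ra)
    ultimately show "s *v v = 0" using ker by blast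
  qed
qed

end

section \<open>Classification\<close>

lemma m_inv_X0: "inv\<^bsub>X0\<^esub> (0, a) = (0, - a)"
  unfolding m_inv_def X0_def by (rule the_equality) auto

lemma sum_lessThan_eq_sum_idx:
  fixes F :: "nat \<Rightarrow> complex"
  assumes "k \<le> CARD('q::{finite,linorder})"
  shows "(\<Sum>a<k. F a) = (\<Sum>i\<in>UNIV. if idx (i :: 'q) < k then F (idx i) else 0)"
proof -
  have "bij_betw idx {i :: 'q. idx i < k} {..<k}"
    unfolding bij_betw_def
  proof
    show "inj_on idx {i :: 'q. idx i < k}" using inj_idx by (rule inj_on_subset) simp
    show "idx ` {i :: 'q. idx i < k} = {..<k}"
    proof (intro Set.set_eqI iffI)
      fix a assume "a \<in> {..<k}"
      then have "a \<in> range (idx :: 'q \<Rightarrow> nat)" using assms by (simp add: range_idx)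
      then show "a \<in> idx ` {i :: 'q. idx i < k}" using \<open>a \<in> {..<k}\<close> by auto
    qed auto
  qed
  from sum.reindex_bij_betw[OF this, of F] show ?thesis
    by (simp add: sum.inter_filter[symmetric])
qed

text \<open>
  The two encodings of the smaller cone, by functions on \<open>{..<k}\<close> and by upper left blocks, agree: the
  quadratic forms coincide after reindexing along \<^const>\<open>idx\<close>.
\<close>

lemma block_in_Pi_cone_iff:
  assumes k: "k \<le> CARD('q::{finite,linorder})"
  shows "(block k A :: 'q cmat) \<in> Pi_cone \<longleftrightarrow> A \<in> Pi_nat k"
proof -
  define x where "x v = (\<chi> i :: 'q. v (idx i))" for v :: "nat \<Rightarrow> complex"
  have form: "Re (\<Sum>a<k. \<Sum>b<k. cnj (v a) * A a b * v b) = x v \<bullet> (block k A *v x v)" for v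
  proof -
    have "(\<Sum>a<k. \<Sum>b<k. cnj (v a) * A a b * v b)
        = (\<Sum>i\<in>UNIV. \<Sum>j\<in>UNIV. cnj (x v $ i) * (block k A :: 'q cmat) $ i $ j * x v $ j)"
      unfolding sum_lessThan_eq_sum_idx[OF k] x_def block_def
      by (intro sum.cong refl) (auto intro!: sum.cong)
    then show ?thesis by (simp only: quadratic_form_eq_inner)
  qed
  have surj: "\<exists>v. x v = y" for y
  proof -
    have "x (\<lambda>a. y $ (inv_into UNIV idx a)) = y"
      by (simp add: x_def vec_eq_iff inv_f_f[OF inj_idx])
    then show ?thesis by blast
  qed
  have herm: "ctransp (block k A) = (block k A :: 'q cmat) \<longleftrightarrow> hermitian_on {..<k} A"
  proof
    assume "hermitian_on {..<k} A"
    then have "cnj (A b a) = A a b" if "a < k" "b < k" for a b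
      using that unfolding hermitian_on_def by (metis lessThan_iff)
    then show "ctransp (block k A) = (block k A :: 'q cmat)"
      by (simp add: vec_eq_iff block_def)
  next
    assume eq: "ctransp (block k A) = (block k A :: 'q cmat)"
    show "hermitian_on {..<k} A"
      unfolding hermitian_on_def
    proof (intro ballI)
      fix a b assume ab: "a \<in> {..<k}" "b \<in> {..<k}"
      then have "a \<in> range (idx :: 'q \<Rightarrow> nat)" "b \<in> range (idx :: 'q \<Rightarrow> nat)"
        using k by (auto simp: range_idx)
      then obtain i j :: 'q where ij: "a = idx i" "b = idx j" by blast
      have "ctransp (block k A) $ j $ i = (block k A :: 'q cmat) $ j $ i" by (simp only: eq)
      then show "A b a = cnj (A a b)" using ab by (simp add: block_def ij)
    qed
  qed
  show ?thesis
    unfolding Pi_cone_iff Pi_nat_def pos_semidef_on_def mem_Collect_eq herm form using surj by metis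
qed

theorem proposition2p13:
  fixes p :: real and X :: "((complex^('q::{finite,linorder})^('q::{finite,linorder})) \<times> real) set"
  assumes "p > 2 * real CARD('q) - 1"
    and "X \<noteq> {}"
    and "subhypergroup p X"
  shows "subgroup X X0 \<or> (\<exists>k\<in>{1..CARD('q)}. \<exists>u\<in>unitary_group. X = X_sub k u)"
proof (cases "\<forall>(r, a)\<in>X. r = 0")
  case True
  have shift: "(0, a + b) \<in> X" if "(0, a) \<in> X" "(0, b) \<in> X" for a b
    using that by (rule subhypergroup_shift[OF assms(1,3)])
  have neg: "(0, - a) \<in> X" if "(0, a) \<in> X" for a
    using that by (rule subhypergroup_inverse[OF assms(1,3)])
  obtain a where a: "(0, a) \<in> X" using True assms(2) by fastforce
  have "(0, 0) \<in> X" using shift[OF a neg[OF a]] by simp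
  have "subgroup X X0"
  proof
    show "X \<subseteq> carrier X0" using True by (auto simp: X0_def)
    show "\<one>\<^bsub>X0\<^esub> \<in> X" using \<open>(0, 0) \<in> X\<close> by (simp add: X0_def)
  next
    fix x y assume "x \<in> X" "y \<in> X"
    then obtain a b where "x = (0, a)" "y = (0, b)" using True by fastforce
    with \<open>x \<in> X\<close> \<open>y \<in> X\<close> show "x \<otimes>\<^bsub>X0\<^esub> y \<in> X" using shift by (simp add: X0_def)
  next
    fix x assume "x \<in> X"
    then show "inv\<^bsub>X0\<^esub> x \<in> X" using True neg by (auto simp: m_inv_X0)
  qed
  then show ?thesis by blast
next
  case False
  then obtain r0 a0 where r0: "(r0, a0) \<in> X" "r0 \<noteq> 0" by auto
  obtain r a where r: "(r, a) \<in> X" and ker: "\<And>s b v. (s, b) \<in> X \<Longrightarrow> r *v v = 0 \<Longrightarrow> s *v v = 0"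
    using subhypergroup_minimal_kernel[OF assms(1,3,2)] by blast
  have "r \<noteq> 0"
  proof
    assume "r = 0"
    then have "r0 *v v = 0" for v using ker[OF r0(1)] by simp
    then have "r0 = 0" by (intro matrix_eq_columnwise) simp
    then show False using r0(2) by simp
  qed
  have rP: "r \<in> Pi_cone" using r by (rule subhypergroup_in_Pi_cone[OF assms(1,3)])
  obtain u l where u: "u \<in> unitary_group" and r_eq: "r = u ** diag l ** ctransp u"
    and sorted: "\<And>i j. i \<le> j \<Longrightarrow> l j \<le> l i"
    using spectral_theorem[OF Pi_cone_hermitian[OF rP]] by metis
  have l: "0 \<le> l i" for i by (rule diagonalised_nonneg[OF u r_eq rP])
  define k where "k = card {i. 0 < l i}"
  have k_le: "k \<le> CARD('q)" unfolding k_def by (rule card_mono) auto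
  \<comment> \<open>The eigenvalues decrease along the order, so the positive ones fill the first \<open>k\<close> positions.\<close>
  have pos_iff: "0 < l i \<longleftrightarrow> idx i < k" for i
  proof
    assume "0 < l i"
    then have "insert i {j. j < i} \<subseteq> {j. 0 < l j}"
      using sorted by (auto intro: less_le_trans less_imp_le)
    then have "card (insert i {j. j < i}) \<le> k" unfolding k_def by (intro card_mono) auto
    then show "idx i < k" by (simp add: idx_def)
  next
    assume "idx i < k"
    show "0 < l i"
    proof (rule ccontr)
      assume "\<not> 0 < l i"
      then have "{j. 0 < l j} \<subseteq> {j. j < i}"
        using sorted[of i] by (auto simp: not_less[symmetric]) (meson less_le_trans not_le)
      then have "k \<le> idx i" unfolding k_def idx_def by (intro card_mono) auto
      then show False using \<open>idx i < k\<close> by simp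
    qed
  qed
  have "k \<noteq> 0"
  proof
    assume "k = 0"
    then have "l i = 0" for i using pos_iff[of i] l[of i] by simp
    then have "diag l = 0" by (simp add: vec_eq_iff diag_nth)
    then show False using r_eq \<open>r \<noteq> 0\<close> by simp
  qed
  have "X = X_sub k u"
  proof (intro Set.set_eqI iffI)
    fix x assume x: "x \<in> X"
    obtain s c where sc: "x = (s, c)" by (cases x)
    have sP: "s \<in> Pi_cone" using x sc by (auto intro: subhypergroup_in_Pi_cone[OF assms(1,3)])
    \<comment> \<open>In the eigenbasis of \<open>r\<close> the columns of \<open>s\<close> beyond position \<open>k\<close> vanish, hence so do the rows.\<close>
    define M where "M = ctransp u ** s ** u"
    have MP: "M \<in> Pi_cone" using Pi_cone_congruence[OF sP, of "ctransp u"] by (simp add: M_def)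
    have col: "M $ i $ j = 0" if "\<not> idx j < k" for i j
    proof -
      have "l j = 0" using that pos_iff[of j] l[of j] by simp
      then have "r *v (u *v axis j 1) = 0" by (simp add: diagonalised_eigenvector[OF u r_eq])
      then have "s *v (u *v axis j 1) = 0" using x unfolding sc by (intro ker[of s c])
      then have "M *v axis j 1 = 0" by (simp add: M_def matrix_vector_mul_assoc[symmetric])
      then show ?thesis by (metis mult_axis_nth zero_index)
    qed
    have row: "M $ i $ j = 0" if "\<not> idx i < k" for i j
      using col[OF that, of j] Pi_cone_hermitian[OF MP] by (metis complex_cnj_zero ctransp_nth)
    define A where "A a b = M $ (inv_into UNIV idx a) $ (inv_into UNIV idx b)" for a b
    have block: "block k A = M"
      using col row by (auto simp: vec_eq_iff block_def A_def inv_f_f[OF inj_idx])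
    then have "A \<in> Pi_nat k" using block_in_Pi_cone_iff[OF k_le, of A] MP by simp
    moreover have "s = u ** block k A ** ctransp u"
      using u by (simp add: block M_def matrix_mul_assoc unitary_cancel) (simp add: unitary_group_def)
    ultimately show "x \<in> X_sub k u" unfolding X_sub_def sc by blast
  next
    fix x assume "x \<in> X_sub k u"
    then obtain A b where x: "x = (u ** block k A ** ctransp u, b)" and A: "A \<in> Pi_nat k"
      unfolding X_sub_def by blast
    define s where "s = u ** block k A ** ctransp u"
    \<comment> \<open>Multiplying by the pseudoinverse of \<open>r\<close> exhibits \<open>s\<close> as a right multiple of \<open>r\<close>.\<close>
    define Y where "Y = u ** (diag (\<lambda>i. if idx i < k then 1 / l i else 0) ** block k A) ** ctransp u"
    have sP: "s \<in> Pi_cone"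
      unfolding s_def by (intro Pi_cone_congruence) (simp add: block_in_Pi_cone_iff[OF k_le] A)
    have "diag l ** (diag (\<lambda>i. if idx i < k then 1 / l i else 0) ** block k A) = (block k A :: 'q cmat)"
      using pos_iff by (auto simp: vec_eq_iff diag_mult_nth block_def) (metis less_irrefl of_real_eq_0_iff)+
    moreover have "r ** Y = u ** (diag l ** ((ctransp u ** u) ** (diag (\<lambda>i. if idx i < k then 1 / l i else 0) ** block k A))) ** ctransp u"
      by (simp only: r_eq Y_def matrix_mul_assoc)
    ultimately have "s = r ** Y" using u by (simp add: s_def unitary_group_def)
    from subhypergroup_factor[OF assms(1,3) r \<open>r \<noteq> 0\<close> sP this] show "x \<in> X" by (simp add: x s_def)
  qed
  moreover have "k \<in> {1..CARD('q)}" using k_le \<open>k \<noteq> 0\<close> by simp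
  ultimately show ?thesis using u by blast
qed

end
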